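(* For an isotropic random gradient $\nabla_R\mathcal{L}\sim\mathcal{N}(0,I_9)$, define the gradient information retention (GIR) of a Jacobian $J\in\mathbb{R}^{9\times 9}$ as $$\eta(J)=\frac{\mathbb{E}\big[\lVert J^\top\nabla_R\mathcal{L}\rVert^2\big]}{\mathbb{E}\big[\lVert\nabla_R\mathcal{L}\rVert^2\big]}.$$ Then: (1) For SVD-Train near $\mathrm{SO}(3)$ (that is, $s_1,s_2,s_3\approx 1$): $\eta(J_{\mathrm{SVD}})=\frac13$. Two-thirds of the gradient energy is lost. (2) For direct 9D regression: $\eta(J_{\mathrm{id}})=1$. All gradient energy is retained. The lost $6$-dimensional component corresponds to the normal space of $\mathrm{SO}(3)$ at $R$: perturbations that change singular values ($3$ dimensions) and symmetric off-diagonal deformations ($3$ dimensions). This normal component carries information about how far $M$ is from $\mathrm{SO}(3)$. SVD discards it, so the optimizer receives no signal pushing $M$ toward orthogonality. Direct regression retains this signal, explaining why networks trained with mean squared error (MSE) naturally converge to near-orthogonal outputs.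
   Context: A network outputs a matrix $M\in\mathbb{R}^{3\times 3}$ with singular value decomposition $M=U\Sigma V^\top$, singular values $s_1\ge s_2\ge s_3$, and $\det(M)>0$; $R=UV^\top\in\mathrm{SO}(3)$ is its orthogonal projection to a rotation. SVD-Train means that the training loss $\mathcal{L}$ is evaluated on $R$ and gradients are backpropagated through $M\mapsto R$, so that $\nabla_M\mathcal{L}=J_{\mathrm{SVD}}^\top\nabla_R\mathcal{L}$ with $J_{\mathrm{SVD}}=\frac{\partial\,\mathrm{vec}(R)}{\partial\,\mathrm{vec}(M)}\in\mathbb{R}^{9\times 9}$. Direct 9D regression means that the loss is the squared Frobenius distance between the raw matrix $M$ and the target rotation, with no orthogonalization during training, so the Jacobian is $J_{\mathrm{id}}=I_9$, the $9\times 9$ identity. *)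

theory Defs
  imports "HOL-Probability.Probability"
begin

(* Norm and inner product of real^3^3 are the Frobenius ones. *)
type_synonym mat3 = "real^3^3"

(* R^9 is indexed by the nine positions (i, j) of a 3x3 matrix instead of 1..9;
   row-major and column-major stacking differ from this only in the names of the indices. *)
type_synonym vec9 = "real^(3 \<times> 3)"
type_synonym mat9 = "real^(3 \<times> 3)^(3 \<times> 3)"

definition vectorize :: "mat3 \<Rightarrow> vec9" where
  "vectorize A = (\<chi> p. A $ fst p $ snd p)"

definition unvectorize :: "vec9 \<Rightarrow> mat3" where
  "unvectorize x = (\<chi> i j. x $ (i, j))"

definition SO3 :: "mat3 set" where
  "SO3 = {Q. rotation_matrix Q}"

definition diag_matrix :: "real^3 \<Rightarrow> mat3" where
  "diag_matrix d = (\<chi> i j. if i = j then d $ i else 0)"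

definition is_svd :: "mat3 \<Rightarrow> mat3 \<Rightarrow> real^3 \<Rightarrow> mat3 \<Rightarrow> bool" where
  "is_svd M U s V \<longleftrightarrow>
     orthogonal_matrix U \<and> orthogonal_matrix V \<and>
     s $ 1 \<ge> s $ 2 \<and> s $ 2 \<ge> s $ 3 \<and> s $ 3 \<ge> 0 \<and>
     M = U ** diag_matrix s ** transpose V"

(* The factors of an SVD are not unique, but U V^T is as soon as M is invertible;
   the definition is meant for det M > 0 only. *)
definition svd_rotation :: "mat3 \<Rightarrow> mat3" where
  "svd_rotation M = (THE R. \<exists>U s V. is_svd M U s V \<and> R = U ** transpose V)"

(* d vec(F M) / d vec(M) *)
definition vec_jacobian :: "(mat3 \<Rightarrow> mat3) \<Rightarrow> mat3 \<Rightarrow> mat9" where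
  "vec_jacobian F M = jacobian (\<lambda>x. vectorize (F (unvectorize x))) (at (vectorize M))"

definition J_SVD :: "mat3 \<Rightarrow> mat9" where
  "J_SVD M = vec_jacobian svd_rotation M"

definition J_id :: "mat3 \<Rightarrow> mat9" where
  "J_id M = vec_jacobian (\<lambda>X. X) M"

definition svd_train_loss :: "(mat3 \<Rightarrow> real) \<Rightarrow> mat3 \<Rightarrow> real" where
  "svd_train_loss L M = L (svd_rotation M)"

definition direct_loss :: "mat3 \<Rightarrow> mat3 \<Rightarrow> real" where
  "direct_loss T M = (norm (M - T))\<^sup>2"

(* g has law N(0, I_9) *)
definition standard_gaussian :: "'w measure \<Rightarrow> ('w \<Rightarrow> vec9) \<Rightarrow> bool" where
  "standard_gaussian \<Omega> g \<longleftrightarrow>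
     distributed \<Omega> lborel g (\<lambda>x. ennreal (\<Prod>p\<in>UNIV. std_normal_density (x $ p)))"

definition GIR :: "'w measure \<Rightarrow> ('w \<Rightarrow> vec9) \<Rightarrow> mat9 \<Rightarrow> real" where
  "GIR \<Omega> g J =
     prob_space.expectation \<Omega> (\<lambda>\<omega>. (norm (transpose J *v g \<omega>))\<^sup>2) /
     prob_space.expectation \<Omega> (\<lambda>\<omega>. (norm (g \<omega>))\<^sup>2)"

definition tangent_SO3 :: "mat3 \<Rightarrow> mat3 set" where
  "tangent_SO3 R =
     {A. \<exists>c. c 0 = R \<and> (\<forall>\<^sub>F t in nhds 0. c t \<in> SO3) \<and>
          (c has_vector_derivative A) (at (0::real))}"

definition normal_SO3 :: "mat3 \<Rightarrow> mat3 set" where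
  "normal_SO3 R = (tangent_SO3 R)\<^sup>\<bottom>"

(* The normal space is a linear subspace, so closest_point is the orthogonal projection onto it. *)
definition normal_part :: "mat3 \<Rightarrow> mat3 \<Rightarrow> mat3" where
  "normal_part R G = closest_point (normal_SO3 R) G"

(* For M = U diag(s) V^T, these directions move M to U diag(s + d) V^T. *)
definition singular_value_directions :: "mat3 \<Rightarrow> mat3 \<Rightarrow> mat3 set" where
  "singular_value_directions U V = {U ** diag_matrix d ** transpose V | d. True}"

definition symmetric_offdiagonal_directions :: "mat3 \<Rightarrow> mat3 \<Rightarrow> mat3 set" where
  "symmetric_offdiagonal_directions U V =
     {U ** S ** transpose V | S. transpose S = S \<and> (\<forall>i. S $ i $ i = 0)}"

end

theory Submission
  imports Defs
begin

text \<open>In the frame of the singular vectors, where \<open>A\<close> stands for \<open>U A V\<^sup>T\<close>, the projection to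
  rotations has derivative \<open>A \<mapsto> ((A\<^sub>i\<^sub>j - A\<^sub>j\<^sub>i) / (s\<^sub>i + s\<^sub>j))\<close>: expand to first order the
  condition that \<open>R\<^sup>T M\<close> is symmetric for the projection \<open>R\<close> of \<open>M\<close>. Differentiability needs no
  control of the singular vectors, since the projection is strongly monotone on matrices with
  positive singular values and therefore Lipschitz. The derivative is self-adjoint and its kernel
  consists of the symmetric \<open>A\<close>, the normal space. An isotropic Gaussian gradient has independent
  standard coordinates \<open>A\<^sub>i\<^sub>j\<close> in every such frame, so the retained energy is
  \<open>\<Sum>\<^sub>i\<^sub>\<noteq>\<^sub>j 2 / (s\<^sub>i + s\<^sub>j)\<^sup>2\<close>, which is 3 out of 9 when all singular values are 1.\<close>

section \<open>Matrices and orthogonal changes of frame\<close>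

text \<open>The delicate point is the case of interest itself: when all singular values are 1,
  \<open>U\<close> and \<open>V\<close> are far from unique and cannot be chosen continuously
  nearby, so differentiating the factors of \<open>U \<Sigma> V^T\<close> is not an option. The
  statements therefore concern arbitrary decompositions: one is fixed at \<open>M\<close>, and each
  nearby matrix brings its own, unrelated one. Only the products \<open>U ** transpose V\<close> are
  compared, and all error constants depend on the smallest singular value of \<open>M\<close> alone,
  so they stay uniform over the neighbours. The same derivative, taken at a rotation, also yields
  the curves that realize all tangent vectors of the rotation group. The ratio 1/3 is exact only
  where the singular values equal 1; nearby it holds as a limit.\<close>

lemma inner_matrix_eq_trace: "inner A B = trace (transpose A ** B)"
  for A B :: "real^'n^'m"
  unfolding inner_vec_def trace_def matrix_matrix_mult_def transpose_def
  by (simp, subst sum.swap, simp)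

lemma transpose_add: "transpose (A + B) = transpose A + transpose B"
  by (simp add: transpose_def vec_eq_iff)

lemma transpose_diff: "transpose (A - B) = transpose A - transpose B"
  for A B :: "'a::ab_group_add^'n^'m"
  by (simp add: transpose_def vec_eq_iff)

lemma transpose_scaleR: "transpose (c *\<^sub>R A) = c *\<^sub>R transpose A"
  by (simp add: transpose_def vec_eq_iff)

lemma inner_transpose: "inner (transpose A) (transpose B) = inner A B"
  for A B :: "real^'n^'m"
  unfolding inner_vec_def transpose_def by (simp, subst sum.swap, simp)

lemma bounded_bilinear_matrix_mult:
  "bounded_bilinear ((**) :: real^'n^'m \<Rightarrow> real^'p^'n \<Rightarrow> real^'p^'m)"
  by (intro bilinear_conv_bounded_bilinear[THEN iffD1])
     (auto simp: bilinear_def linear_iff vec_eq_iff matrix_matrix_mult_def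
        sum_distrib_left sum.distrib algebra_simps)

lemma abs_matrix_mult_entry_le: "\<bar>(A ** B) $ i $ j\<bar> \<le> norm A * norm B"
  for A :: "real^'n^'m" and B :: "real^'p^'n"
proof -
  have "(A ** B) $ i $ j = inner (A $ i) (transpose B $ j)"
    by (simp add: matrix_matrix_mult_def inner_vec_def transpose_def)
  also have "\<bar>\<dots>\<bar> \<le> norm (A $ i) * norm (transpose B $ j)"
    by (rule Cauchy_Schwarz_ineq2)
  also have "\<dots> \<le> norm A * norm (transpose B)"
    by (intro mult_mono Finite_Cartesian_Product.norm_nth_le) auto
  also have "norm (transpose B) = norm B"
    by (simp add: norm_eq_sqrt_inner inner_transpose)
  finally show ?thesis .
qed

text \<open>For orthogonal \<open>U\<close> and \<open>V\<close> this is a Frobenius isometry with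
  inverse \<open>frame (transpose U) (transpose V)\<close>. In the frame of its singular vectors
  \<open>M\<close> becomes \<open>diag_matrix s\<close> and its rotation becomes
  \<open>mat 1\<close>.\<close>

definition frame :: "real^'n^'n \<Rightarrow> real^'n^'n \<Rightarrow> real^'n^'n \<Rightarrow> real^'n^'n" where
  "frame U V A = U ** A ** transpose V"

lemma linear_frame: "linear (frame U V)"
  unfolding frame_def linear_iff
  by (simp add: bounded_bilinear.add_left[OF bounded_bilinear_matrix_mult]
    bounded_bilinear.add_right[OF bounded_bilinear_matrix_mult]
    bounded_bilinear.scaleR_left[OF bounded_bilinear_matrix_mult]
    bounded_bilinear.scaleR_right[OF bounded_bilinear_matrix_mult])

lemma frame_frame: "frame U V (frame P Q A) = frame (U ** P) (V ** Q) A"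
  by (simp add: frame_def matrix_transpose_mul matrix_mul_assoc)

lemma frame_inverse [simp]:
  assumes "orthogonal_matrix U" "orthogonal_matrix V"
  shows "frame (transpose U) (transpose V) (frame U V A) = A"
    and "frame U V (frame (transpose U) (transpose V) A) = A"
  using assms by (simp_all add: frame_frame orthogonal_matrix_def) (simp_all add: frame_def)

lemma inner_frame_left:
  "inner (frame U V A) B = inner A (frame (transpose U) (transpose V) B)"
  unfolding inner_matrix_eq_trace frame_def matrix_transpose_mul transpose_transpose
  by (metis matrix_mul_assoc trace_mul_sym)

lemma inner_frame [simp]:
  assumes "orthogonal_matrix U" "orthogonal_matrix V"
  shows "inner (frame U V A) (frame U V B) = inner A B"
  using assms by (simp add: inner_frame_left)

lemma norm_frame [simp]:
  assumes "orthogonal_matrix U" "orthogonal_matrix V"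
  shows "norm (frame U V A) = norm A"
  using assms by (simp add: norm_eq_sqrt_inner)

lemma transpose_frame: "transpose (frame U V A) = frame V U (transpose A)"
  by (simp add: frame_def matrix_transpose_mul matrix_mul_assoc)

lemma orthogonal_matrix_frame:
  assumes "orthogonal_matrix U" "orthogonal_matrix V" "orthogonal_matrix Q"
  shows "orthogonal_matrix (frame U V Q)"
  using assms unfolding frame_def by (simp add: orthogonal_matrix_mul)

lemma orthogonal_matrix_entry_le_1:
  assumes "orthogonal_matrix Q"
  shows "Q $ i $ j \<le> (1::real)"
proof -
  have "inner (row i Q) (row i Q) = 1"
    using assms by (simp add: orthogonal_matrix_orthonormal_rows norm_eq_1)
  then have "norm (Q $ i) = 1" by (simp add: norm_eq_1 row_def)
  with component_le_norm_cart[of "Q $ i" j] show ?thesis by linarith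
qed

lemma norm_orthogonal_matrix_sq:
  assumes "orthogonal_matrix (Q :: real^'n^'n)"
  shows "(norm Q)\<^sup>2 = CARD('n)"
  using assms by (simp add: power2_norm_eq_inner inner_matrix_eq_trace orthogonal_matrix_def trace_I)

lemma inner_diag_matrix: "inner (diag_matrix d) A = (\<Sum>i\<in>UNIV. d $ i * A $ i $ i)"
  by (simp add: inner_vec_def diag_matrix_def if_distrib[where f="\<lambda>x. x * _"] cong: if_cong)

lemma compact_orthogonal_matrices: "compact {Q :: real^'n^'n. orthogonal_matrix Q}"
proof -
  have "bounded {Q :: real^'n^'n. orthogonal_matrix Q}"
    by (rule boundedI[where B="sqrt CARD('n)"])
       (simp add: real_le_rsqrt norm_orthogonal_matrix_sq)
  moreover have "closed {Q :: real^'n^'n. transpose Q ** Q = mat 1}"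
    unfolding matrix_matrix_mult_def transpose_def
    by (intro closed_Collect_eq continuous_intros)
  ultimately show ?thesis
    by (simp add: compact_eq_bounded_closed orthogonal_matrix)
qed

section \<open>Existence of singular value decompositions\<close>

text \<open>These plane rotations are curves in the orthogonal group through \<open>mat 1\<close> at
  \<open>t = 0\<close>; their velocities there span the skew matrices, so they suffice as test
  curves for a first-order condition.\<close>

definition givens :: "3 \<Rightarrow> 3 \<Rightarrow> real \<Rightarrow> mat3" where
  "givens i j t = (\<chi> k l. if k = l then (if k = i \<or> k = j then cos t else 1)
     else if k = i \<and> l = j then - sin t else if k = j \<and> l = i then sin t else 0)"

lemma orthogonal_matrix_givens:
  assumes "i \<noteq> j"
  shows "orthogonal_matrix (givens i j t)"
proof -
  have [simp]: "cos t * cos t + sin t * sin t = 1" "sin t * sin t + cos t * cos t = 1"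
    using sin_cos_squared_add[of t] by (simp_all add: power2_eq_square add.commute)
  show ?thesis
    unfolding orthogonal_matrix vec_eq_iff forall_3 matrix_matrix_mult_def sum_3 transpose_def
      givens_def mat_def
    using exhaust_3[of i] exhaust_3[of j] assms by (elim disjE) simp_all
qed

text \<open>First-order condition at the maximizer: along \<open>givens i j\<close> the objective
  has slope \<open>B $ j $ i - B $ i $ j\<close> at 0, which must vanish.\<close>

lemma symmetric_if_identity_maximizes:
  fixes B :: mat3
  assumes max: "\<And>Q. orthogonal_matrix Q \<Longrightarrow> inner B Q \<le> inner B (mat 1)"
  shows "transpose B = B"
proof -
  have "B $ j $ i = B $ i $ j" if "i \<noteq> j" for i j
  proof -
    have "((\<lambda>t. inner B (givens i j t)) has_real_derivative B $ j $ i - B $ i $ j) (at 0)"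
      using exhaust_3[of i] exhaust_3[of j] that
      by (auto simp: inner_vec_def sum_3 givens_def intro!: derivative_eq_intros)
    moreover have "inner B (givens i j t) \<le> inner B (givens i j 0)" for t
    proof -
      have "givens i j 0 = mat 1"
        by (simp add: givens_def mat_def vec_eq_iff)
      then show ?thesis using max[OF orthogonal_matrix_givens[OF that]] by simp
    qed
    ultimately have "B $ j $ i - B $ i $ j = 0"
      by (intro DERIV_local_max[where d=1]) auto
    then show ?thesis by simp
  qed
  then show ?thesis
    by (metis (no_types, lifting) transpose_def vec_eq_iff vec_lambda_beta)
qed

text \<open>A maximizer of \<open>tr (C U\<^sup>T M V)\<close> over orthogonal \<open>U\<close>, \<open>V\<close> with \<open>C = diag(3,2,1)\<close> is an SVD:
  rotating \<open>U\<close> or \<open>V\<close> shows that \<open>A C\<close> and \<open>A\<^sup>T C\<close> are symmetric for \<open>A = U\<^sup>T M V\<close>, so \<open>A\<close> is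
  diagonal, while sign changes and transpositions show that its diagonal is nonnegative and
  sorted.\<close>
lemma ex_svd: "\<exists>U s V. is_svd M U s V"
proof -
  let ?O = "{Q :: mat3. orthogonal_matrix Q}"
  define C where "C = diag_matrix (vector [3,2,1])"
  have C: "inner C X = 3 * X $ 1 $ 1 + 2 * X $ 2 $ 2 + X $ 3 $ 3" for X
    by (simp add: C_def inner_diag_matrix sum_3 vector_3)
  define f where "f = (\<lambda>(U, V). inner C (transpose U ** M ** V))"
  have "compact (?O \<times> ?O)"
    by (intro compact_Times compact_orthogonal_matrices)
  moreover have "?O \<times> ?O \<noteq> {}"
    using orthogonal_matrix_id by blast
  moreover have "continuous_on (?O \<times> ?O) f"
    unfolding f_def matrix_matrix_mult_def transpose_def case_prod_beta
    by (intro continuous_intros)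
  ultimately obtain p where p: "p \<in> ?O \<times> ?O" "\<And>q. q \<in> ?O \<times> ?O \<Longrightarrow> f q \<le> f p"
    using continuous_attains_sup by meson
  obtain U V where UV: "p = (U, V)" by force
  with p have O: "orthogonal_matrix U" "orthogonal_matrix V" by auto
  define A where "A = transpose U ** M ** V"
  have max: "inner C (transpose P ** A ** Q) \<le> inner C A"
    if "orthogonal_matrix P" "orthogonal_matrix Q" for P Q
  proof -
    have "f (U ** P, V ** Q) \<le> f (U, V)"
      using p(2) O that by (simp add: UV orthogonal_matrix_mul)
    then show ?thesis
      by (simp add: f_def A_def matrix_transpose_mul matrix_mul_assoc)
  qed
  have "transpose (A ** transpose C) = A ** transpose C"
  proof (rule symmetric_if_identity_maximizes)
    fix Q :: mat3 assume "orthogonal_matrix Q"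
    have "inner (A ** transpose C) P = inner C (transpose P ** A)" for P
      unfolding inner_matrix_eq_trace matrix_transpose_mul transpose_transpose
      by (metis inner_commute inner_matrix_eq_trace matrix_mul_assoc matrix_transpose_mul
        trace_mul_sym transpose_transpose)
    with max[OF \<open>orthogonal_matrix Q\<close> orthogonal_matrix_id]
    show "inner (A ** transpose C) Q \<le> inner (A ** transpose C) (mat 1)" by simp
  qed
  then have 1: "A $ i $ j * C $ j $ j = A $ j $ i * C $ i $ i" for i j
    using exhaust_3[of i] exhaust_3[of j]
    by (auto simp: vec_eq_iff forall_3 matrix_matrix_mult_def sum_3 transpose_def C_def diag_matrix_def)
  have "transpose (transpose A ** C) = transpose A ** C"
  proof (rule symmetric_if_identity_maximizes)
    fix Q :: mat3 assume "orthogonal_matrix Q"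
    have "inner (transpose A ** C) P = inner C (A ** P)" for P
      unfolding inner_matrix_eq_trace matrix_transpose_mul transpose_transpose
      by (simp add: matrix_mul_assoc)
    with max[OF orthogonal_matrix_id \<open>orthogonal_matrix Q\<close>]
    show "inner (transpose A ** C) Q \<le> inner (transpose A ** C) (mat 1)" by simp
  qed
  then have 2: "A $ j $ i * C $ j $ j = A $ i $ j * C $ i $ i" for i j
    using exhaust_3[of i] exhaust_3[of j]
    by (auto simp: vec_eq_iff forall_3 matrix_matrix_mult_def sum_3 transpose_def C_def diag_matrix_def)
  \<comment> \<open>Combining the two relations gives
    \<open>A $ i $ j * (C $ i $ i)^2 = A $ i $ j * (C $ j $ j)^2\<close>; the weights 3, 2, 1 have
    distinct squares, so the entry is 0.\<close>
  have off: "A $ i $ j = 0" if "i \<noteq> j" for i j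
    using 1[of i j] 2[of i j] that exhaust_3[of i] exhaust_3[of j]
    by (auto simp: C_def diag_matrix_def)
  define s where "s = (\<chi> i. A $ i $ i)"
  have A: "A = diag_matrix s"
    using off by (simp add: vec_eq_iff diag_matrix_def s_def)
  have nonneg: "s $ i \<ge> 0" for i
  proof -
    \<comment> \<open>Flipping the sign of one column changes the objective by
      \<open>-2 * C $ i $ i * s $ i\<close>, and the weight is positive.\<close>
    let ?Q = "diag_matrix (\<chi> k. if k = i then -1 else 1)"
    have "orthogonal_matrix ?Q"
      unfolding orthogonal_matrix using exhaust_3[of i]
      by (auto simp: vec_eq_iff forall_3 matrix_matrix_mult_def sum_3 transpose_def diag_matrix_def mat_def)
    from max[OF orthogonal_matrix_id this] exhaust_3[of i] show ?thesis
      by (auto simp: A C matrix_matrix_mult_def sum_3 diag_matrix_def mat_def transpose_def)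
  qed
  have sort: "s $ 1 \<ge> s $ 2"
  proof -
    \<comment> \<open>Conjugation by this transposition swaps two diagonal entries; since the
      weights decrease, a maximum must have the larger entry first.\<close>
    let ?P = "vector [vector [0,1,0], vector [1,0,0], vector [0,0,1]] :: mat3"
    have "orthogonal_matrix ?P"
      unfolding orthogonal_matrix
      by (simp add: vec_eq_iff forall_3 matrix_matrix_mult_def sum_3 transpose_def mat_def vector_3)
    from max[OF this this] show ?thesis
      by (simp add: A C matrix_matrix_mult_def sum_3 diag_matrix_def transpose_def vector_3)
  qed
  have sort': "s $ 2 \<ge> s $ 3"
  proof -
    let ?P = "vector [vector [1,0,0], vector [0,0,1], vector [0,1,0]] :: mat3"
    have "orthogonal_matrix ?P"
      unfolding orthogonal_matrix
      by (simp add: vec_eq_iff forall_3 matrix_matrix_mult_def sum_3 transpose_def mat_def vector_3)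
    from max[OF this this] show ?thesis
      by (simp add: A C matrix_matrix_mult_def sum_3 diag_matrix_def transpose_def vector_3)
  qed
  have "M = U ** diag_matrix s ** transpose V"
    using O frame_inverse(2)[of U V M] unfolding A[symmetric] A_def frame_def transpose_transpose by simp
  then have "is_svd M U s V"
    using O nonneg[of 3] sort sort' by (simp add: is_svd_def)
  then show ?thesis by blast
qed

section \<open>The projection to rotations and its derivative\<close>

lemma is_svd_frame:
  assumes "is_svd M U s V"
  shows "orthogonal_matrix U" "orthogonal_matrix V" "M = frame U V (diag_matrix s)"
    "0 \<le> s $ 3" "s $ 3 \<le> s $ i"
  using assms exhaust_3[of i] by (auto simp: is_svd_def frame_def)

text \<open>For orthogonal \<open>Q\<close> each defect
  \<open>1 - frame (transpose U) (transpose V) Q $ i $ i\<close> is nonnegative, so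
  \<open>U ** transpose V\<close> maximizes the inner product with \<open>M\<close> among orthogonal
  matrices.\<close>

lemma inner_svd_diff:
  assumes "is_svd M U s V"
  shows "inner M (U ** transpose V - Q) =
    (\<Sum>i\<in>UNIV. s $ i * (1 - frame (transpose U) (transpose V) Q $ i $ i))"
proof -
  note M = is_svd_frame[OF assms]
  have "frame (transpose U) (transpose V) (U ** transpose V) = mat 1"
    using frame_inverse(1)[OF M(1,2), of "mat 1"] by (simp add: frame_def)
  then show ?thesis
    by (subst M(3)) (simp add: inner_frame_left linear_diff[OF linear_frame] inner_diag_matrix mat_def)
qed

text \<open>The squared distance is a sum of the same defects with constant weight, which makes it
  comparable with the weighted sum in \<open>inner_svd_diff\<close>.\<close>

lemma norm_rotation_diff:
  assumes "is_svd M U s V" "orthogonal_matrix Q"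
  shows "(norm (U ** transpose V - Q))\<^sup>2 =
    2 * (\<Sum>i\<in>UNIV. 1 - frame (transpose U) (transpose V) Q $ i $ i)"
proof -
  note M = is_svd_frame[OF assms(1)]
  have "orthogonal_matrix (U ** transpose V)"
    using M by (simp add: orthogonal_matrix_mul)
  moreover have "inner (mat 1) X = (\<Sum>i\<in>UNIV. X $ i $ i)" for X :: mat3
    by (simp add: inner_matrix_eq_trace trace_def)
  then have "inner (U ** transpose V) Q =
      (\<Sum>i\<in>UNIV. frame (transpose U) (transpose V) Q $ i $ i)"
    using inner_frame_left[of U V "mat 1" Q] by (simp add: frame_def)
  ultimately show ?thesis
    using assms(2) norm_orthogonal_matrix_sq[of Q] norm_orthogonal_matrix_sq[of "U ** transpose V"]
    by (simp add: power2_norm_eq_inner inner_diff_left inner_diff_right inner_commute sum_3)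
qed

text \<open>Strong monotonicity of the projection to rotations; this is what makes it
  single-valued and Lipschitz without any continuity of the singular vectors.\<close>
lemma svd_rotation_monotone:
  assumes M: "is_svd M U s V" and M': "is_svd M' U' s' V'"
  shows "s $ 3 / 2 * (norm (U ** transpose V - U' ** transpose V'))\<^sup>2
    \<le> inner (M - M') (U ** transpose V - U' ** transpose V')"
proof -
  let ?R = "U ** transpose V" and ?R' = "U' ** transpose V'"
  let ?Q = "frame (transpose U) (transpose V) ?R'"
  let ?Q' = "frame (transpose U') (transpose V') ?R"
  note O = is_svd_frame[OF M] is_svd_frame[OF M']
  have R: "orthogonal_matrix ?R" "orthogonal_matrix ?R'"
    using O by (simp_all add: orthogonal_matrix_mul)
  have "s $ 3 / 2 * (norm (?R - ?R'))\<^sup>2 = (\<Sum>i\<in>UNIV. s $ 3 * (1 - ?Q $ i $ i))"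
    unfolding norm_rotation_diff[OF M R(2)] by (simp add: sum_3 algebra_simps)
  \<comment> \<open>The defects are nonnegative, so the smallest singular value may be replaced by
    each \<open>s $ i\<close>.\<close>
  also have "\<dots> \<le> (\<Sum>i\<in>UNIV. s $ i * (1 - ?Q $ i $ i))"
    using O R
    by (intro sum_mono mult_right_mono)
       (simp_all add: orthogonal_matrix_entry_le_1 orthogonal_matrix_frame)
  also have "\<dots> = inner M (?R - ?R')"
    by (rule inner_svd_diff[OF M, symmetric])
  \<comment> \<open>With the roles exchanged, only the sign is extracted; the constant thus involves
    \<open>M\<close> and not \<open>M'\<close>.\<close>
  also have "inner M' (?R' - ?R) \<ge> 0"
    unfolding inner_svd_diff[OF M'] using O R order_trans[OF O(9) O(10)]
    by (intro sum_nonneg mult_nonneg_nonneg)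
       (simp_all add: orthogonal_matrix_entry_le_1 orthogonal_matrix_frame)
  then have "inner M (?R - ?R') \<le> inner (M - M') (?R - ?R')"
    by (simp add: inner_diff_left inner_diff_right)
  finally show ?thesis .
qed

text \<open>Cauchy-Schwarz bounds the right-hand side of the monotonicity inequality; one factor of
  the distance then cancels.\<close>

lemma svd_rotation_lipschitz:
  assumes M: "is_svd M U s V" and M': "is_svd M' U' s' V'" and pos: "s $ 3 > 0"
  shows "norm (U ** transpose V - U' ** transpose V') \<le> 2 / s $ 3 * norm (M - M')"
proof -
  let ?d = "norm (U ** transpose V - U' ** transpose V')"
  have "s $ 3 / 2 * ?d\<^sup>2 \<le> norm (M - M') * ?d"
    using svd_rotation_monotone[OF M M'] norm_cauchy_schwarz order_trans by blast
  then have "s $ 3 / 2 * ?d \<le> norm (M - M')"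
    by (cases "?d = 0") (simp_all add: power2_eq_square)
  then show ?thesis using pos by (simp add: field_simps)
qed

text \<open>Uniqueness is the Lipschitz bound for two decompositions of the same matrix.\<close>

lemma svd_rotation_eq:
  assumes M: "is_svd M U s V" and pos: "s $ 3 > 0"
  shows "svd_rotation M = U ** transpose V"
  unfolding svd_rotation_def
proof (rule the_equality)
  fix R assume "\<exists>U s V. is_svd M U s V \<and> R = U ** transpose V"
  then obtain U' s' V' where M': "is_svd M U' s' V'" and R: "R = U' ** transpose V'"
    by blast
  show "R = U ** transpose V"
    using svd_rotation_lipschitz[OF M M' pos] by (simp add: R)
qed (use M in blast)

lemma transpose_diag_matrix [simp]: "transpose (diag_matrix d) = diag_matrix d"
  by (simp add: diag_matrix_def transpose_def vec_eq_iff)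

lemma det_diag_matrix: "det (diag_matrix s) = s $ 1 * s $ 2 * s $ 3"
  by (simp add: det_3 diag_matrix_def)

text \<open>The determinant of \<open>M\<close> is the product of the singular values times
  \<open>det U * det V\<close>, which is 1 or -1. Positivity rules out a zero singular value and the
  sign -1, so no sign correction is needed to land in the rotations.\<close>

lemma svd_det_pos:
  assumes M: "is_svd M U s V" and det: "det M > 0"
  shows "s $ i > 0" "rotation_matrix (U ** transpose V)"
proof -
  note O = is_svd_frame[OF M]
  let ?u = "det U * det V" and ?p = "s $ 1 * s $ 2 * s $ 3"
  have D: "det M = ?p * ?u"
    by (subst O(3)) (simp add: frame_def det_mul det_diag_matrix)
  have u: "?u = 1 \<or> ?u = -1"
    using det_orthogonal_matrix[OF O(1)] det_orthogonal_matrix[OF O(2)] by auto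
  have "s $ 3 \<noteq> 0" using D det by auto
  with O(4) have s: "s $ 3 > 0" by linarith
  then show "s $ i > 0"
    using O(5)[of i] by linarith
  have "s $ 1 > 0" "s $ 2 > 0"
    using s O(5)[of 1] O(5)[of 2] by linarith+
  then have "?p > 0" using s by simp
  then have "?u = 1" using D det u by auto
  then show "rotation_matrix (U ** transpose V)"
    using O by (simp add: rotation_matrix_def orthogonal_matrix_mul det_mul)
qed

section \<open>First-order expansion of the projection\<close>

definition svd_rotation_deriv :: "mat3 \<Rightarrow> real^3 \<Rightarrow> mat3 \<Rightarrow> mat3 \<Rightarrow> mat3" where
  "svd_rotation_deriv U s V H =
     (let A = frame (transpose U) (transpose V) H
      in frame U V (\<chi> i j. (A $ i $ j - A $ j $ i) / (s $ i + s $ j)))"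

lemma norm_matrix_le_sum: "norm A \<le> (\<Sum>i\<in>UNIV. \<Sum>j\<in>UNIV. \<bar>A $ i $ j\<bar>)"
  for A :: "real^'n^'m"
proof -
  have "norm A \<le> (\<Sum>i\<in>UNIV. norm (A $ i))"
    unfolding norm_vec_def by (rule L2_set_le_sum) simp
  also have "\<dots> \<le> (\<Sum>i\<in>UNIV. \<Sum>j\<in>UNIV. \<bar>A $ i $ j\<bar>)"
    by (intro sum_mono norm_le_l1_cart)
  finally show ?thesis .
qed

text \<open>In the frame of \<open>M\<close>, symmetry of
  \<open>transpose Q ** (diag_matrix s + A)\<close> and orthogonality of
  \<open>Q = mat 1 + W\<close> are two equations for \<open>W $ i $ j\<close> and
  \<open>W $ j $ i\<close>, linear up to the products \<open>transpose W ** A\<close> and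
  \<open>transpose W ** W\<close>. By the Lipschitz bound these products are quadratic in
  \<open>A\<close>.\<close>

lemma svd_rotation_taylor:
  assumes M: "is_svd M U s V" and M': "is_svd M' U' s' V'" and pos: "s $ 3 > 0"
  shows "norm (U' ** transpose V' - U ** transpose V - svd_rotation_deriv U s V (M' - M))
    \<le> 54 / (s $ 3)\<^sup>2 * (norm (M' - M))\<^sup>2"
proof -
  note O = is_svd_frame[OF M] is_svd_frame[OF M']
  let ?F = "frame (transpose U) (transpose V)"
  define A where "A = ?F (M' - M)"
  define Q where "Q = ?F (U' ** transpose V')"
  define W where "W = Q - mat 1"
  define K where "K = (\<chi> i j. (A $ i $ j - A $ j $ i) / (s $ i + s $ j))"
  have FR: "?F (U ** transpose V) = mat 1"
    using frame_inverse(1)[OF O(1,2), of "mat 1"] by (simp add: frame_def)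
  have FM: "?F M = diag_matrix s"
    using O(1-3) by simp
  have nA: "norm A = norm (M' - M)"
    using O by (simp add: A_def)
  have W: "W = ?F (U' ** transpose V' - U ** transpose V)"
    by (simp add: W_def Q_def linear_diff[OF linear_frame] FR)
  have nW: "norm W \<le> 2 / s $ 3 * norm A"
    using svd_rotation_lipschitz[OF M M' pos] O by (simp add: W nA norm_minus_commute)
  have Q: "orthogonal_matrix Q"
    using O by (simp add: Q_def orthogonal_matrix_frame orthogonal_matrix_mul)
  \<comment> \<open>If \<open>R'\<close> is the rotation of \<open>M'\<close>, then
    \<open>R'^T M' = V' diag(s') V'^T\<close> is symmetric; this is the same fact in the frame of
    \<open>M\<close>.\<close>
  have "transpose Q ** (diag_matrix s + A) = transpose Q ** ?F M'"
    by (simp add: A_def linear_diff[OF linear_frame] FM)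
  also have "\<dots> = transpose V ** V' ** (transpose U' ** (U ** transpose U) ** U') **
      diag_matrix s' ** transpose V' ** V"
    by (simp add: O(8) Q_def frame_def matrix_transpose_mul matrix_mul_assoc)
  also have "\<dots> = frame (transpose V ** V') (transpose V ** V') (diag_matrix s')"
    using O(1,6) by (simp add: orthogonal_matrix_def frame_def matrix_transpose_mul matrix_mul_assoc)
  finally have "transpose (transpose Q ** (diag_matrix s + A)) = transpose Q ** (diag_matrix s + A)"
    by (simp add: transpose_frame transpose_diag_matrix)
  then have sym: "(transpose Q ** (diag_matrix s + A)) $ i $ j =
      (transpose Q ** (diag_matrix s + A)) $ j $ i" for i j
    by (simp add: transpose_def vec_eq_iff)
  have exp: "(transpose Q ** (diag_matrix s + A)) $ i $ j =
      (if i = j then s $ i else 0) + A $ i $ j + W $ j $ i * s $ j + (transpose W ** A) $ i $ j" for i j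
  proof -
    have "transpose Q = mat 1 + transpose W"
      by (simp add: W_def transpose_diff)
    then have "transpose Q ** (diag_matrix s + A) =
        diag_matrix s + A + transpose W ** diag_matrix s + transpose W ** A"
      by (simp add: bounded_bilinear.add_left[OF bounded_bilinear_matrix_mult]
        bounded_bilinear.add_right[OF bounded_bilinear_matrix_mult])
    moreover have "(transpose W ** diag_matrix s) $ i $ j = W $ j $ i * s $ j"
      by (simp add: matrix_matrix_mult_def diag_matrix_def transpose_def
        if_distrib[where f="\<lambda>x. _ * x"] cong: if_cong)
    ultimately show ?thesis by (simp add: diag_matrix_def)
  qed
  have "transpose W + W + transpose W ** W = 0"
  proof -
    have "transpose (mat 1 + W) ** (mat 1 + W) = mat 1"
      using Q by (simp add: W_def orthogonal_matrix)
    then show ?thesis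
      by (simp add: transpose_add bounded_bilinear.add_left[OF bounded_bilinear_matrix_mult]
        bounded_bilinear.add_right[OF bounded_bilinear_matrix_mult] algebra_simps)
  qed
  then have orth: "W $ j $ i + W $ i $ j + (transpose W ** W) $ i $ j = 0" for i j
    by (simp add: vec_eq_iff transpose_def)
  have "\<bar>(W - K) $ i $ j\<bar> \<le> 6 / (s $ 3)\<^sup>2 * (norm A)\<^sup>2" for i j
  proof -
    let ?f = "(transpose W ** W) $ i $ j"
      and ?e = "(transpose W ** A) $ i $ j - (transpose W ** A) $ j $ i"
    have sij: "s $ i > 0" "s $ j > 0" "s $ 3 \<le> s $ i" "s $ 3 \<le> s $ j"
      using pos O(5)[of i] O(5)[of j] by linarith+
    \<comment> \<open>Orthogonality eliminates \<open>W $ j $ i\<close> from the symmetry equation,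
      leaving \<open>W $ i $ j\<close> with coefficient \<open>s $ i + s $ j\<close>.\<close>
    have "s $ j * ?f = s $ j * - (W $ j $ i + W $ i $ j)"
      using orth[of j i] by (intro arg_cong[of _ _ "\<lambda>x. s $ j * x"]) linarith
    then have "(s $ i + s $ j) * W $ i $ j = A $ i $ j - A $ j $ i + (?e - s $ j * ?f)"
      using sym[of i j] unfolding exp by (simp add: algebra_simps split: if_splits)
    then have "W $ i $ j = (A $ i $ j - A $ j $ i + (?e - s $ j * ?f)) / (s $ i + s $ j)"
      using sij by (simp add: field_simps)
    then have "(W - K) $ i $ j = (?e - s $ j * ?f) / (s $ i + s $ j)"
      by (simp add: K_def add_divide_distrib)
    also have "\<bar>\<dots>\<bar> = \<bar>?e - s $ j * ?f\<bar> / (s $ i + s $ j)"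
      using sij by simp
    also have "\<dots> \<le> (\<bar>?e\<bar> + s $ j * \<bar>?f\<bar>) / (s $ i + s $ j)"
      using sij by (intro divide_right_mono order_trans[OF abs_triangle_ineq4]) (simp_all add: abs_mult)
    also have "\<dots> = \<bar>?e\<bar> / (s $ i + s $ j) + s $ j / (s $ i + s $ j) * \<bar>?f\<bar>"
      by (simp add: add_divide_distrib)
    \<comment> \<open>Since \<open>s $ j / (s $ i + s $ j)\<close> is at most 1, no upper bound on
      the singular values enters.\<close>
    also have "\<dots> \<le> \<bar>?e\<bar> / (2 * s $ 3) + 1 * \<bar>?f\<bar>"
      using sij pos by (intro add_mono divide_left_mono mult_right_mono) (simp_all add: field_simps add_pos_pos)
    \<comment> \<open>From here the bounds are substituted for subterms in which the right-hand side
      is monotone. The \<open>?f\<close> part contributes 4 and the \<open>?e\<close> part 2 to the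
      constant 6; the nine entries then give 54.\<close>
    also have "\<bar>?f\<bar> \<le> norm W * norm W"
      using abs_matrix_mult_entry_le[of "transpose W" W i j]
      by (simp add: norm_eq_sqrt_inner inner_transpose)
    also have "\<dots> \<le> (2 / s $ 3 * norm A) * (2 / s $ 3 * norm A)"
      using nW by (intro mult_mono) (auto intro: order_trans[OF norm_ge_zero])
    also have "\<bar>?e\<bar> \<le> 2 * (norm W * norm A)"
      using abs_matrix_mult_entry_le[of "transpose W" A i j] abs_matrix_mult_entry_le[of "transpose W" A j i]
      by (simp add: norm_eq_sqrt_inner inner_transpose)
    also have "\<dots> \<le> 2 * (2 / s $ 3 * norm A * norm A)"
      using nW by (intro mult_left_mono mult_right_mono) auto
    also have "2 * (2 / s $ 3 * norm A * norm A) / (2 * s $ 3) + 1 * ((2 / s $ 3 * norm A) * (2 / s $ 3 * norm A))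
        = 6 / (s $ 3)\<^sup>2 * (norm A)\<^sup>2"
      by (simp add: power2_eq_square field_simps)
    finally show ?thesis using pos by (simp add: divide_right_mono)
  qed
  then have "norm (W - K) \<le> (\<Sum>i\<in>(UNIV::3 set). \<Sum>j\<in>(UNIV::3 set). 6 / (s $ 3)\<^sup>2 * (norm A)\<^sup>2)"
    by (intro order_trans[OF norm_matrix_le_sum] sum_mono)
  also have "\<dots> = 54 / (s $ 3)\<^sup>2 * (norm (M' - M))\<^sup>2"
    by (simp add: nA)
  also have "W - K = ?F (U' ** transpose V' - U ** transpose V - svd_rotation_deriv U s V (M' - M))"
    using O unfolding linear_diff[OF linear_frame, of _ _ "_ - _"]
    by (simp add: W svd_rotation_deriv_def Let_def K_def A_def)
  finally show ?thesis using O by simp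
qed

lemma has_derivative_at_quadratic:
  fixes f :: "'a::real_normed_vector \<Rightarrow> 'b::real_normed_vector"
  assumes D: "bounded_linear D"
    and err: "eventually (\<lambda>y. norm (f y - f x - D (y - x)) \<le> C * (norm (y - x))\<^sup>2) (nhds x)"
  shows "(f has_derivative D) (at x)"
proof -
  have "((\<lambda>y. norm (f y - f x - D (y - x)) / norm (y - x)) \<longlongrightarrow> 0) (at x)"
  proof (rule Lim_null_comparison)
    have "eventually (\<lambda>y. norm (f y - f x - D (y - x)) \<le> C * (norm (y - x))\<^sup>2) (at x)"
      using err by (simp add: eventually_nhds eventually_at_topological) blast
    then show "eventually (\<lambda>y. norm (norm (f y - f x - D (y - x)) / norm (y - x)) \<le> C * norm (y - x)) (at x)"
    proof eventually_elim
      case (elim y)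
      show ?case
        by (cases "y = x") (use elim in \<open>simp_all add: pos_divide_le_eq power2_eq_square mult.assoc\<close>)
    qed
    show "((\<lambda>y. C * norm (y - x)) \<longlongrightarrow> 0) (at x)"
      by (auto intro!: tendsto_eq_intros)
  qed
  then show ?thesis
    using D by (simp add: has_derivative_iff_norm)
qed

lemma linear_svd_rotation_deriv: "linear (svd_rotation_deriv U s V)"
proof -
  have "linear (\<lambda>A :: mat3. (\<chi> i j. (A $ i $ j - A $ j $ i) / (s $ i + s $ j)) :: mat3)"
    by (simp add: linear_iff vec_eq_iff add_divide_distrib diff_divide_distrib algebra_simps)
  then have "linear (frame U V \<circ> (\<lambda>A. \<chi> i j. (A $ i $ j - A $ j $ i) / (s $ i + s $ j))
      \<circ> frame (transpose U) (transpose V))"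
    by (intro linear_compose linear_frame)
  then show ?thesis
    by (simp add: svd_rotation_deriv_def[abs_def] Let_def o_def)
qed

text \<open>The denominators are symmetric in \<open>i\<close> and \<open>j\<close>, and taking skew
  parts is self-adjoint. Hence the Jacobian equals its transpose, and backpropagation applies the
  derivative itself.\<close>

lemma svd_rotation_deriv_self_adjoint:
  "inner (svd_rotation_deriv U s V A) B = inner A (svd_rotation_deriv U s V B)"
proof -
  have "inner (\<chi> i j. (A $ i $ j - A $ j $ i) / (s $ i + s $ j)) B =
      inner A (\<chi> i j. (B $ i $ j - B $ j $ i) / (s $ i + s $ j))" for A B :: mat3
    by (simp add: inner_vec_def sum_3 algebra_simps diff_divide_distrib)
  then show ?thesis
    unfolding svd_rotation_deriv_def Let_def
    using inner_frame_left[of "transpose U" "transpose V" A] by (simp add: inner_frame_left)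
qed

lemma svd_rotation_has_derivative:
  assumes M: "is_svd M U s V" and det: "det M > 0"
  shows "(svd_rotation has_derivative svd_rotation_deriv U s V) (at M)"
proof (rule has_derivative_at_quadratic)
  show "bounded_linear (svd_rotation_deriv U s V)"
    using linear_svd_rotation_deriv linear_conv_bounded_linear by blast
  have "open {X :: mat3. det X > 0}"
    unfolding det_3 by (intro open_Collect_less continuous_intros)
  with det have "eventually (\<lambda>X. det X > 0) (nhds M)"
    using eventually_nhds by blast
  then show "eventually (\<lambda>X. norm (svd_rotation X - svd_rotation M - svd_rotation_deriv U s V (X - M))
      \<le> 54 / (s $ 3)\<^sup>2 * (norm (X - M))\<^sup>2) (nhds M)"
  proof eventually_elim
    case (elim X)
    \<comment> \<open>Any decomposition of \<open>X\<close> will do: the Taylor constant comes from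
      \<open>M\<close> only.\<close>
    obtain U' s' V' where X: "is_svd X U' s' V'" using ex_svd by blast
    show ?case
      using svd_rotation_taylor[OF M X] svd_rotation_eq[OF M] svd_rotation_eq[OF X]
        svd_det_pos(1)[OF M det] svd_det_pos(1)[OF X elim] by simp
  qed
qed

section \<open>Nearest rotation\<close>

lemma svd_rotation_SO3:
  assumes "det M > 0"
  shows "svd_rotation M \<in> SO3"
proof -
  obtain U s V where M: "is_svd M U s V" using ex_svd by blast
  then show ?thesis
    using svd_det_pos[OF M assms] svd_rotation_eq[OF M] by (simp add: SO3_def)
qed

text \<open>All orthogonal matrices have the same norm, so minimizing the distance to
  \<open>M\<close> means maximizing the inner product with \<open>M\<close>. This justifies calling
  \<open>svd_rotation\<close> the orthogonal projection.\<close>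

lemma infdist_SO3:
  assumes M: "is_svd M U s V" and det: "det M > 0"
  shows "infdist M SO3 = norm (M - svd_rotation M)"
proof (rule antisym)
  note R = svd_rotation_SO3[OF det]
  show "infdist M SO3 \<le> norm (M - svd_rotation M)"
    using infdist_le[OF R, of M] by (simp add: dist_norm)
  show "norm (M - svd_rotation M) \<le> infdist M SO3"
  proof -
    have "SO3 \<noteq> {}" using R by auto
    moreover have "norm (M - svd_rotation M) \<le> dist M Q" if "Q \<in> SO3" for Q
    proof -
    from that have Q: "orthogonal_matrix Q"
      by (simp add: SO3_def rotation_matrix_def)
    have R': "orthogonal_matrix (svd_rotation M)"
      using R by (simp add: SO3_def rotation_matrix_def)
    have "0 \<le> inner M (U ** transpose V - Q)"
      unfolding inner_svd_diff[OF M]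
      using svd_det_pos(1)[OF M det] is_svd_frame[OF M] Q
      by (intro sum_nonneg mult_nonneg_nonneg)
         (simp_all add: orthogonal_matrix_entry_le_1 orthogonal_matrix_frame less_imp_le)
    then have "inner M Q \<le> inner M (svd_rotation M)"
      using svd_rotation_eq[OF M] svd_det_pos(1)[OF M det] by (simp add: inner_diff_right)
    then have "(norm (M - svd_rotation M))\<^sup>2 \<le> (norm (M - Q))\<^sup>2"
      using norm_orthogonal_matrix_sq[OF Q] norm_orthogonal_matrix_sq[OF R']
      by (simp add: power2_norm_eq_inner inner_diff_left inner_diff_right inner_commute)
    then show "norm (M - svd_rotation M) \<le> dist M Q"
      by (simp add: dist_norm)
    qed
    ultimately show ?thesis
      by (simp add: infdist_notempty cINF_greatest)
  qed
qed

section \<open>Vectorization and Jacobian matrices\<close>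

lemma vectorize_unvectorize [simp]: "vectorize (unvectorize x) = x" "unvectorize (vectorize A) = A"
  by (simp_all add: vectorize_def unvectorize_def vec_eq_iff)

lemma linear_vectorize: "linear vectorize"
  by (simp add: linear_iff vectorize_def vec_eq_iff)

lemma linear_unvectorize: "linear unvectorize"
  by (simp add: linear_iff unvectorize_def vec_eq_iff)

lemma inner_vectorize [simp]: "inner (vectorize A) (vectorize B) = inner A B"
  by (simp add: inner_vec_def vectorize_def sum.cartesian_product UNIV_Times_UNIV[symmetric]
    split_beta del: UNIV_Times_UNIV)

lemma norm_vectorize [simp]: "norm (vectorize A) = norm A"
  by (simp add: norm_eq_sqrt_inner)

lemma norm_unvectorize [simp]: "norm (unvectorize x) = norm x"
  using norm_vectorize[of "unvectorize x"] by simp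

lemma vec_jacobian_has_derivative:
  assumes "(F has_derivative D) (at M)"
  shows "((\<lambda>x. vectorize (F (unvectorize x))) has_derivative
    (\<lambda>h. vectorize (D (unvectorize h)))) (at (vectorize M))"
proof -
  have *: "(vectorize has_derivative vectorize) (at X)" "(unvectorize has_derivative unvectorize) (at x)"
    for X x
    by (intro bounded_linear_imp_has_derivative linear_conv_bounded_linear[THEN iffD1]
      linear_vectorize linear_unvectorize)+
  have "((F \<circ> unvectorize) has_derivative (D \<circ> unvectorize)) (at (vectorize M))"
    by (rule diff_chain_at) (use assms * in simp_all)
  from diff_chain_at[OF this *(1)] show ?thesis by (simp add: o_def)
qed

text \<open>The library's \<open>jacobian\<close> rests on a chosen derivative; once
  differentiability is known, uniqueness of the derivative identifies it.\<close>

lemma vec_jacobian_mult: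
  assumes "(F has_derivative D) (at M)"
  shows "vec_jacobian F M *v x = vectorize (D (unvectorize x))"
proof -
  note d = vec_jacobian_has_derivative[OF assms]
  have "vec_jacobian F M = matrix (\<lambda>h. vectorize (D (unvectorize h)))"
    unfolding vec_jacobian_def jacobian_def using frechet_derivative_at[OF d] by simp
  then show ?thesis
    using fun_cong[OF matrix_vector_mul(2)[OF has_derivative_linear[OF d]], of x] by simp
qed

lemma transpose_eq_if_self_adjoint:
  fixes J :: "real^'n^'n"
  assumes "\<And>x y. inner (J *v x) y = inner x (J *v y)"
  shows "transpose J = J"
proof -
  have "transpose J *v x = J *v x" for x
  proof -
    have "inner y (transpose J *v x) = inner y (J *v x)" for y
      using assms[of x y] dot_lmul_matrix[of x J y] by (simp add: inner_commute)
    then show ?thesis using vector_eq_ldot by blast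
  qed
  then show ?thesis by (simp add: matrix_eq)
qed

lemma J_SVD_mult:
  assumes "is_svd M U s V" "det M > 0"
  shows "J_SVD M *v x = vectorize (svd_rotation_deriv U s V (unvectorize x))"
  unfolding J_SVD_def by (rule vec_jacobian_mult[OF svd_rotation_has_derivative[OF assms]])

lemma transpose_J_SVD:
  assumes "is_svd M U s V" "det M > 0"
  shows "transpose (J_SVD M) = J_SVD M"
proof (rule transpose_eq_if_self_adjoint)
  fix x y
  show "inner (J_SVD M *v x) y = inner x (J_SVD M *v y)"
    using inner_vectorize[of _ "unvectorize y"] inner_vectorize[of "unvectorize x"]
    by (simp add: J_SVD_mult[OF assms] svd_rotation_deriv_self_adjoint)
qed

lemma J_id_eq: "J_id M = mat 1"
proof -
  have "J_id M *v x = mat 1 *v x" for x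
    unfolding J_id_def by (subst vec_jacobian_mult[OF has_derivative_ident]) simp
  then show ?thesis by (simp add: matrix_eq)
qed

section \<open>Tangent and normal space of the rotation group\<close>

lemma bounded_linear_transpose: "bounded_linear (transpose :: real^'n^'m \<Rightarrow> real^'m^'n)"
  by (simp add: linear_conv_bounded_linear[symmetric] linear_iff transpose_add transpose_scaleR)

text \<open>The product \<open>transpose (c t) ** c t\<close> is constant near 0, so its derivative
  vanishes.\<close>

lemma tangent_SO3_skew:
  assumes "A \<in> tangent_SO3 R"
  shows "transpose R ** A + transpose A ** R = 0"
proof -
  obtain c where c: "c 0 = R" "\<forall>\<^sub>F t in nhds 0. c t \<in> SO3"
      "(c has_vector_derivative A) (at (0::real))"
    using assms by (auto simp: tangent_SO3_def)
  have "((\<lambda>t. transpose (c t)) has_vector_derivative transpose A) (at 0)"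
    by (rule bounded_linear.has_vector_derivative[OF bounded_linear_transpose c(3)])
  from bounded_bilinear.has_vector_derivative[OF bounded_bilinear_matrix_mult this c(3)]
  have "((\<lambda>t. transpose (c t) ** c t) has_vector_derivative transpose R ** A + transpose A ** R) (at 0)"
    by (simp add: c(1))
  moreover have "((\<lambda>t. transpose (c t) ** c t) has_vector_derivative 0) (at 0)"
  proof -
    have ev: "\<forall>\<^sub>F t in nhds 0. mat 1 = transpose (c t) ** c t"
      using c(2) by eventually_elim (simp add: SO3_def rotation_matrix_def orthogonal_matrix)
    show ?thesis
      unfolding has_vector_derivative_def
    proof (rule has_derivative_transform_eventually)
      show "((\<lambda>t. mat 1) has_derivative (\<lambda>x. x *\<^sub>R 0)) (at 0)" by simp
      show "\<forall>\<^sub>F t in at 0. mat 1 = transpose (c t) ** c t"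
        using ev by (simp add: eventually_at_filter eventually_mono)
      show "mat 1 = transpose (c 0) ** c 0" using ev eventually_nhds_x_imp_x by blast
    qed simp
  qed
  ultimately show ?thesis by (rule vector_derivative_unique_at)
qed

lemma symmetric_matrix_entry:
  assumes "transpose A = A"
  shows "A $ j $ i = A $ i $ j"
proof -
  have "transpose A $ i $ j = A $ i $ j" by (simp only: assms)
  then show ?thesis by (simp only: transpose_def vec_lambda_beta)
qed

lemma skew_matrix_entry:
  assumes "transpose A = - A"
  shows "A $ j $ i = - A $ i $ j"
proof -
  have "transpose A $ i $ j = - A $ i $ j" by (simp only: assms vector_uminus_component)
  then show ?thesis by (simp only: transpose_def vec_lambda_beta)
qed

lemma diag_matrix_1: "diag_matrix (\<chi> i. 1) = mat 1"
  by (simp add: diag_matrix_def mat_def vec_eq_iff)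

text \<open>For the converse inclusion, the line \<open>R + t A\<close> is projected back to the
  rotations. At a rotation all singular values are 1, so in the frame the derivative of the
  projection takes the skew part and fixes \<open>A\<close>; the projected line therefore has
  velocity \<open>A\<close>.\<close>

lemma tangent_SO3_eq:
  assumes U: "orthogonal_matrix U" and V: "orthogonal_matrix V"
    and rot: "rotation_matrix (U ** transpose V)"
  shows "tangent_SO3 (U ** transpose V) =
    {A. transpose (frame (transpose U) (transpose V) A) = - frame (transpose U) (transpose V) A}"
    (is "tangent_SO3 ?R = {A. transpose (?F A) = - ?F A}")
proof (intro equalityI subsetI; clarsimp)
  fix A assume "A \<in> tangent_SO3 ?R"
  \<comment> \<open>Conjugation by \<open>V\<close> turns \<open>R^T A = V U^T A\<close> into
    \<open>U^T A V\<close>, which is \<open>?F A\<close>.\<close>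
  then have "transpose V ** (transpose ?R ** A + transpose A ** ?R) ** V = 0"
    by (simp add: tangent_SO3_skew bounded_bilinear.zero_left[OF bounded_bilinear_matrix_mult]
      bounded_bilinear.zero_right[OF bounded_bilinear_matrix_mult])
  then have "(transpose V ** V) ** transpose U ** A ** V +
      transpose V ** transpose A ** U ** (transpose V ** V) = 0"
    by (simp del: matrix_mul_lid matrix_mul_rid
        add: bounded_bilinear.add_left[OF bounded_bilinear_matrix_mult]
        bounded_bilinear.add_right[OF bounded_bilinear_matrix_mult]
        matrix_transpose_mul matrix_mul_assoc)
  then have "?F A + transpose (?F A) = 0"
    using V by (simp add: orthogonal_matrix[THEN iffD1] frame_def matrix_transpose_mul matrix_mul_assoc)
  then show "transpose (?F A) = - ?F A"
    by (simp add: add_eq_0_iff)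
next
  fix A assume A: "transpose (?F A) = - ?F A"
  have R: "is_svd ?R U (\<chi> i. 1) V"
    using U V by (simp add: is_svd_def diag_matrix_1)
  have det: "det ?R > 0"
    using rot by (simp add: rotation_matrix_def)
  let ?D = "svd_rotation_deriv U (\<chi> i. 1) V"
  have "(?F A $ i $ j - ?F A $ j $ i) / 2 = ?F A $ i $ j" for i j
    using skew_matrix_entry[OF A, of i j] by simp
  then have "(\<chi> i j. (?F A $ i $ j - ?F A $ j $ i) / 2) = ?F A"
    by (simp add: vec_eq_iff)
  then have DA: "?D A = A"
    using U V by (simp add: svd_rotation_deriv_def Let_def)
  define c where "c t = svd_rotation (?R + t *\<^sub>R A)" for t
  have "c 0 = ?R"
    using svd_rotation_eq[OF R] by (simp add: c_def)
  moreover have "\<forall>\<^sub>F t in nhds 0. c t \<in> SO3"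
  proof -
    have "open {t. det (?R + t *\<^sub>R A) > 0}"
      unfolding det_3 by (intro open_Collect_less continuous_intros)
    then have "\<forall>\<^sub>F t in nhds 0. det (?R + t *\<^sub>R A) > 0"
      by (rule eventually_nhds_in_open[THEN eventually_mono]) (use det in simp_all)
    then show ?thesis
      by eventually_elim (simp add: c_def svd_rotation_SO3)
  qed
  moreover have "(c has_vector_derivative A) (at 0)"
  proof -
    have "((\<lambda>t. ?R + t *\<^sub>R A) has_derivative (\<lambda>h. h *\<^sub>R A)) (at 0)"
      by (auto intro!: derivative_eq_intros)
    moreover have "(svd_rotation has_derivative ?D) (at (?R + 0 *\<^sub>R A))"
      using svd_rotation_has_derivative[OF R det] by simp
    ultimately have "((svd_rotation \<circ> (\<lambda>t. ?R + t *\<^sub>R A)) has_derivative (?D \<circ> (\<lambda>h. h *\<^sub>R A))) (at 0)"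
      by (rule diff_chain_at)
    then show ?thesis
      by (simp add: o_def has_vector_derivative_def c_def[abs_def]
        linear_cmul[OF linear_svd_rotation_deriv] DA)
  qed
  ultimately show "A \<in> tangent_SO3 ?R"
    by (auto simp: tangent_SO3_def)
qed

lemma inner_skew_transpose:
  fixes K S :: "real^'n^'n"
  assumes "transpose K = - K"
  shows "inner K (transpose S) = - inner K S"
  using inner_transpose[of K S] assms by simp

text \<open>A normal \<open>X\<close> is tested against the skew part of its own frame coordinates;
  being orthogonal to it forces that part to vanish. Conversely, symmetric and skew matrices are
  orthogonal.\<close>

lemma normal_SO3_eq:
  assumes U: "orthogonal_matrix U" and V: "orthogonal_matrix V"
    and rot: "rotation_matrix (U ** transpose V)"
  shows "normal_SO3 (U ** transpose V) =
    {A. transpose (frame (transpose U) (transpose V) A) = frame (transpose U) (transpose V) A}"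
    (is "_ = {A. transpose (?F A) = ?F A}")
proof (intro equalityI subsetI)
  fix X assume X: "X \<in> normal_SO3 (U ** transpose V)"
  let ?K = "?F X - transpose (?F X)"
  have "transpose ?K = - ?K" by (simp add: transpose_diff)
  then have "frame U V ?K \<in> tangent_SO3 (U ** transpose V)"
    using tangent_SO3_eq[OF assms] U V by simp
  with X have "inner (frame U V ?K) X = 0"
    by (auto simp: normal_SO3_def orthogonal_comp_def orthogonal_def)
  then have *: "inner ?K (?F X) = 0" by (simp add: inner_frame_left)
  moreover have "inner ?K (transpose (?F X)) = - inner ?K (?F X)"
    by (rule inner_skew_transpose) fact
  ultimately have "inner ?K ?K = 0" by (simp only: inner_diff_right)
  then show "X \<in> {A. transpose (?F A) = ?F A}" by simp
next
  fix X assume X: "X \<in> {A. transpose (?F A) = ?F A}"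
  have "inner Y X = 0" if "transpose (?F Y) = - ?F Y" for Y
  proof -
    have "inner Y X = inner (?F Y) (?F X)" using U V by simp
    moreover have "inner (?F Y) (?F X) = - inner (?F Y) (?F X)"
      using inner_skew_transpose[OF that, of "?F X"] X by simp
    ultimately show ?thesis by simp
  qed
  then show "X \<in> normal_SO3 (U ** transpose V)"
    using tangent_SO3_eq[OF assms] by (auto simp: normal_SO3_def orthogonal_comp_def orthogonal_def)
qed

section \<open>Orthogonal projection onto the normal space\<close>

lemma closest_point_subspace_eq:
  fixes S :: "'a::euclidean_space set"
  assumes S: "subspace S" and x: "x \<in> S" and orth: "\<And>z. z \<in> S \<Longrightarrow> inner (a - x) z = 0"
  shows "closest_point S a = x"
proof (rule closest_point_unique[symmetric])
  show "convex S" "closed S"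
    using S by (simp_all add: subspace_imp_convex closed_subspace)
  show "\<forall>z\<in>S. dist a x \<le> dist a z"
  proof
    fix z assume "z \<in> S"
    then have "inner (a - x) (x - z) = 0"
      using S x by (intro orth subspace_diff)
    then have "(norm (a - x + (x - z)))\<^sup>2 = (norm (a - x))\<^sup>2 + (norm (x - z))\<^sup>2"
      using norm_add_Pythagorean[of "a - x" "x - z"] by (simp add: orthogonal_def)
    then have "(norm (a - x))\<^sup>2 \<le> (norm (a - z))\<^sup>2" by simp
    then show "dist a x \<le> dist a z" by (simp add: dist_norm)
  qed
qed (fact x)

text \<open>The symmetric part in the frame is normal, and the remainder is skew, hence tangent and
  orthogonal to the normal space.\<close>

lemma normal_part_eq:
  assumes U: "orthogonal_matrix U" and V: "orthogonal_matrix V"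
    and rot: "rotation_matrix (U ** transpose V)"
  shows "normal_part (U ** transpose V) G =
    frame U V ((1/2) *\<^sub>R (frame (transpose U) (transpose V) G +
      transpose (frame (transpose U) (transpose V) G)))"
    (is "_ = frame U V ((1/2) *\<^sub>R (?A + transpose ?A))")
  unfolding normal_part_def
proof (rule closest_point_subspace_eq)
  let ?R = "U ** transpose V" and ?P = "frame U V ((1/2) *\<^sub>R (?A + transpose ?A))"
  show "subspace (normal_SO3 ?R)"
    unfolding normal_SO3_def by (rule subspace_orthogonal_comp)
  show "?P \<in> normal_SO3 ?R"
    using U V by (simp add: normal_SO3_eq[OF assms] transpose_scaleR transpose_add add.commute)
  fix Z assume "Z \<in> normal_SO3 ?R"
  moreover have "frame (transpose U) (transpose V) (G - ?P) = (1/2) *\<^sub>R (?A - transpose ?A)"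
    using U V by (simp add: linear_diff[OF linear_frame] algebra_simps)
  then have "transpose (frame (transpose U) (transpose V) (G - ?P)) =
      - frame (transpose U) (transpose V) (G - ?P)"
    by (simp add: transpose_scaleR transpose_diff flip: scaleR_minus_right)
  then have "G - ?P \<in> tangent_SO3 ?R"
    by (simp add: tangent_SO3_eq[OF assms])
  ultimately show "inner (G - ?P) Z = 0"
    by (auto simp: normal_SO3_def orthogonal_comp_def orthogonal_def)
qed

section \<open>The two summands of the normal space and their dimensions\<close>

lemma singular_value_directions_eq:
  "singular_value_directions U V = range (\<lambda>d. frame U V (diag_matrix d))"
  by (auto simp: singular_value_directions_def frame_def)

text \<open>A linear parametrization of the symmetric matrices with zero diagonal, so that
  dimensions follow from injectivity.\<close>

definition offdiag_matrix :: "real^3 \<Rightarrow> mat3" where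
  "offdiag_matrix x = vector [vector [0, x$1, x$2], vector [x$1, 0, x$3], vector [x$2, x$3, 0]]"

lemma offdiag_matrix_entries [simp]:
  "offdiag_matrix x $ 1 $ 1 = 0" "offdiag_matrix x $ 1 $ 2 = x $ 1" "offdiag_matrix x $ 1 $ 3 = x $ 2"
  "offdiag_matrix x $ 2 $ 1 = x $ 1" "offdiag_matrix x $ 2 $ 2 = 0" "offdiag_matrix x $ 2 $ 3 = x $ 3"
  "offdiag_matrix x $ 3 $ 1 = x $ 2" "offdiag_matrix x $ 3 $ 2 = x $ 3" "offdiag_matrix x $ 3 $ 3 = 0"
  by (simp_all add: offdiag_matrix_def vector_3)

lemma range_offdiag_matrix:
  "range offdiag_matrix = {S. transpose S = S \<and> (\<forall>i. S $ i $ i = 0)}"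
proof (intro equalityI subsetI)
  fix S :: mat3 assume "S \<in> {S. transpose S = S \<and> (\<forall>i. S $ i $ i = 0)}"
  then have S: "transpose S = S" "\<And>i. S $ i $ i = 0" by auto
  have "S = offdiag_matrix (vector [S $ 1 $ 2, S $ 1 $ 3, S $ 2 $ 3])"
    by (simp add: vec_eq_iff forall_3 vector_3 S(2) symmetric_matrix_entry[OF S(1), of 2 1]
      symmetric_matrix_entry[OF S(1), of 3 1] symmetric_matrix_entry[OF S(1), of 3 2])
  then show "S \<in> range offdiag_matrix" by blast
qed (auto simp: vec_eq_iff forall_3 transpose_def)

lemma symmetric_offdiagonal_directions_eq:
  "symmetric_offdiagonal_directions U V = range (\<lambda>x. frame U V (offdiag_matrix x))"
proof -
  have "symmetric_offdiagonal_directions U V = frame U V ` range offdiag_matrix"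
    unfolding range_offdiag_matrix by (auto simp: symmetric_offdiagonal_directions_def frame_def)
  then show ?thesis by (simp add: image_image)
qed

lemma normal_SO3_decomposition:
  assumes U: "orthogonal_matrix U" and V: "orthogonal_matrix V"
    and rot: "rotation_matrix (U ** transpose V)"
  shows "normal_SO3 (U ** transpose V) =
    range (\<lambda>(d, x). frame U V (diag_matrix d) + frame U V (offdiag_matrix x))"
proof (intro equalityI subsetI)
  fix X assume "X \<in> normal_SO3 (U ** transpose V)"
  then have sym: "transpose (frame (transpose U) (transpose V) X) = frame (transpose U) (transpose V) X"
    by (simp add: normal_SO3_eq[OF assms])
  define S where "S = frame (transpose U) (transpose V) X"
  have X: "X = frame U V S"
    using U V by (simp add: S_def)
  note S = sym[folded S_def, THEN symmetric_matrix_entry]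
  have "S = diag_matrix (\<chi> i. S $ i $ i) + offdiag_matrix (vector [S $ 1 $ 2, S $ 1 $ 3, S $ 2 $ 3])"
    by (simp add: S[of 2 1] S[of 3 1] S[of 3 2] vec_eq_iff forall_3 vector_3 diag_matrix_def)
  then obtain d x where "S = diag_matrix d + offdiag_matrix x" by blast
  then have "X = frame U V (diag_matrix d) + frame U V (offdiag_matrix x)"
    by (simp add: X linear_add[OF linear_frame])
  then show "X \<in> range (\<lambda>(d, x). frame U V (diag_matrix d) + frame U V (offdiag_matrix x))"
    by auto
next
  fix X assume "X \<in> range (\<lambda>(d, x). frame U V (diag_matrix d) + frame U V (offdiag_matrix x))"
  moreover have "transpose (offdiag_matrix x) = offdiag_matrix x" for x
    using range_offdiag_matrix by blast
  ultimately show "X \<in> normal_SO3 (U ** transpose V)"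
    using U V by (auto simp: normal_SO3_eq[OF assms] linear_add[OF linear_frame] transpose_add)
qed

lemma inner_diag_offdiag: "inner (diag_matrix d) (offdiag_matrix x) = 0"
  by (simp add: inner_diag_matrix sum_3)

lemma dim_range_linear_inj:
  fixes f :: "'a::euclidean_space \<Rightarrow> 'b::euclidean_space"
  assumes "linear f" "\<And>x. f x = 0 \<Longrightarrow> x = 0"
  shows "dim (range f) = DIM('a)"
  using assms by (simp add: dim_image_eq linear_injective_0)

lemma linear_diag_matrix: "linear diag_matrix"
  by (auto simp: linear_iff diag_matrix_def vec_eq_iff)

lemma linear_offdiag_matrix: "linear offdiag_matrix"
  by (simp add: linear_iff vec_eq_iff forall_3)

lemma frame_eq_0_iff:
  assumes "orthogonal_matrix U" "orthogonal_matrix V"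
  shows "frame U V A = 0 \<longleftrightarrow> A = 0"
  using norm_frame[OF assms, of A] by (metis norm_eq_zero)

lemma dim_singular_value_directions:
  assumes "orthogonal_matrix U" "orthogonal_matrix V"
  shows "dim (singular_value_directions U V) = 3"
proof -
  have "linear (\<lambda>d. frame U V (diag_matrix d))"
    using linear_compose[OF linear_diag_matrix linear_frame] by (simp add: o_def)
  then have "dim (range (\<lambda>d. frame U V (diag_matrix d))) = DIM(real^3)"
    by (rule dim_range_linear_inj)
       (simp only: frame_eq_0_iff[OF assms], simp add: vec_eq_iff forall_3 diag_matrix_def)
  then show ?thesis by (simp add: singular_value_directions_eq)
qed

lemma dim_symmetric_offdiagonal_directions:
  assumes "orthogonal_matrix U" "orthogonal_matrix V"
  shows "dim (symmetric_offdiagonal_directions U V) = 3"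
proof -
  have "linear (\<lambda>x. frame U V (offdiag_matrix x))"
    using linear_compose[OF linear_offdiag_matrix linear_frame] by (simp add: o_def)
  then have "dim (range (\<lambda>x. frame U V (offdiag_matrix x))) = DIM(real^3)"
    by (rule dim_range_linear_inj)
       (simp only: frame_eq_0_iff[OF assms], simp add: vec_eq_iff forall_3)
  then show ?thesis by (simp add: symmetric_offdiagonal_directions_eq)
qed

lemma dim_normal_SO3:
  assumes "orthogonal_matrix U" "orthogonal_matrix V" "rotation_matrix (U ** transpose V)"
  shows "dim (normal_SO3 (U ** transpose V)) = 6"
proof -
  let ?f = "\<lambda>(d, x). frame U V (diag_matrix d) + frame U V (offdiag_matrix x)"
  have "linear ?f"
    by (simp add: linear_iff linear_add[OF linear_frame] linear_cmul[OF linear_frame]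
      linear_add[OF linear_diag_matrix] linear_cmul[OF linear_diag_matrix]
      linear_add[OF linear_offdiag_matrix] linear_cmul[OF linear_offdiag_matrix] algebra_simps)
  moreover have "p = 0" if "?f p = 0" for p
  proof -
    have "frame U V (diag_matrix (fst p) + offdiag_matrix (snd p)) = 0"
      using that by (simp add: split_beta linear_add[OF linear_frame])
    then have "diag_matrix (fst p) + offdiag_matrix (snd p) = 0"
      using assms by (simp add: frame_eq_0_iff)
    then show ?thesis
      by (simp add: vec_eq_iff forall_3 diag_matrix_def prod_eq_iff)
  qed
  ultimately have "dim (range ?f) = DIM((real^3) \<times> (real^3))"
    by (rule dim_range_linear_inj)
  then show ?thesis by (simp add: normal_SO3_decomposition[OF assms])
qed

section \<open>Gaussian gradients\<close>

text \<open>Fubini: Lebesgue measure is the image of a product of one-dimensional Lebesgue measures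
  under the map from coordinates to vectors.\<close>

lemma lborel_integral_prod:
  fixes f :: "'a::euclidean_space \<Rightarrow> real \<Rightarrow> real"
  assumes f: "\<And>b. b \<in> Basis \<Longrightarrow> integrable lborel (f b)"
  shows "integrable lborel (\<lambda>x. \<Prod>b\<in>Basis. f b (x \<bullet> b))"
    and "(\<integral>x. (\<Prod>b\<in>Basis. f b (x \<bullet> b)) \<partial>lborel) = (\<Prod>b\<in>Basis. integral\<^sup>L lborel (f b))"
proof -
  interpret product_sigma_finite "\<lambda>_ :: 'a. lborel :: real measure"
    by standard
  let ?P = "Pi\<^sub>M Basis (\<lambda>_ :: 'a. lborel :: real measure)"
    and ?T = "\<lambda>y. \<Sum>b\<in>Basis. y b *\<^sub>R (b :: 'a)"
  have [measurable]: "f b \<in> borel_measurable borel" if "b \<in> Basis" for b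
    using borel_measurable_integrable[OF f[OF that]] by simp
  have T: "?T \<in> measurable ?P borel"
    by measurable
  have F: "(\<lambda>x. \<Prod>b\<in>Basis. f b (x \<bullet> b)) \<in> borel_measurable borel"
    by measurable
  have *: "(\<Prod>b\<in>Basis. f b (?T y \<bullet> b)) = (\<Prod>b\<in>Basis. f b (y b))" for y
    by (intro prod.cong) simp_all
  show "integrable lborel (\<lambda>x. \<Prod>b\<in>Basis. f b (x \<bullet> b))"
    unfolding lborel_eq[where 'a='a] integrable_distr_eq[OF T F] *
    by (intro product_integrable_prod finite_Basis f)
  show "(\<integral>x. (\<Prod>b\<in>Basis. f b (x \<bullet> b)) \<partial>lborel) = (\<Prod>b\<in>Basis. integral\<^sup>L lborel (f b))"
    unfolding lborel_eq[where 'a='a] integral_distr[OF T F] *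
    by (intro product_integral_prod finite_Basis f)
qed

lemma lborel_integral_prod_cart:
  fixes f :: "'n::finite \<Rightarrow> real \<Rightarrow> real"
  assumes f: "\<And>p. integrable lborel (f p)"
  shows "integrable lborel (\<lambda>x :: real^'n. \<Prod>p\<in>UNIV. f p (x $ p))"
    and "(\<integral>x. (\<Prod>p\<in>UNIV. f p (x $ p)) \<partial>(lborel :: (real^'n) measure)) =
      (\<Prod>p\<in>UNIV. integral\<^sup>L lborel (f p))"
proof -
  \<comment> \<open>The factors are reindexed from positions to basis vectors along the bijection
    \<open>p \<mapsto> axis p 1\<close>.\<close>
  let ?h = "\<lambda>b. f (inv (\<lambda>p. axis p (1::real)) b)"
  have inj: "inj (\<lambda>p :: 'n. axis p (1::real))"
    by (auto simp: inj_on_def axis_eq_axis)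
  have B: "(Basis :: (real^'n) set) = range (\<lambda>p. axis p 1)"
    by (auto simp: Basis_vec_def)
  have 1: "(\<Prod>b\<in>Basis. ?h b (x \<bullet> b)) = (\<Prod>p\<in>UNIV. f p (x $ p))" for x :: "real^'n"
    by (simp add: B prod.reindex[OF inj] inv_f_f[OF inj] inner_axis)
  have 2: "(\<Prod>b\<in>(Basis :: (real^'n) set). integral\<^sup>L lborel (?h b)) = (\<Prod>p\<in>UNIV. integral\<^sup>L lborel (f p))"
    by (simp add: B prod.reindex[OF inj] inv_f_f[OF inj])
  show "integrable lborel (\<lambda>x :: real^'n. \<Prod>p\<in>UNIV. f p (x $ p))"
    using lborel_integral_prod(1)[where 'a="real^'n" and f="?h"] f by (simp add: 1)
  show "(\<integral>x. (\<Prod>p\<in>UNIV. f p (x $ p)) \<partial>(lborel :: (real^'n) measure)) =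
      (\<Prod>p\<in>UNIV. integral\<^sup>L lborel (f p))"
    using lborel_integral_prod(2)[where 'a="real^'n" and f="?h"] f by (simp add: 1 2)
qed

text \<open>The energies are quadratic in the gradient, so the law of \<open>g\<close> enters them
  only through this identity covariance.\<close>

lemma standard_gaussian_coordinate_moment:
  assumes "standard_gaussian \<Omega> g"
  shows "integrable \<Omega> (\<lambda>\<omega>. g \<omega> $ p * g \<omega> $ q)"
    and "(\<integral>\<omega>. g \<omega> $ p * g \<omega> $ q \<partial>\<Omega>) = (if p = q then 1 else 0)"
proof -
  let ?d = "\<lambda>x :: vec9. \<Prod>p\<in>UNIV. std_normal_density (x $ p)"
  have D: "distributed \<Omega> lborel g (\<lambda>x. ennreal (?d x))"
    using assms by (simp add: standard_gaussian_def)
  \<comment> \<open>The exponent of coordinate \<open>r\<close> in the monomial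
    \<open>x $ p * x $ q\<close>: 2 at \<open>p\<close> if \<open>p = q\<close>, otherwise 1 at
    both, and 0 elsewhere. The integrand thus splits into one-dimensional Gaussian moments.\<close>
  define k where "k r = (if r = p then 1 else 0) + (if r = q then 1 else (0::nat))" for r
  let ?f = "\<lambda>r t. std_normal_density t * t ^ k r"
  have *: "?d x * (x $ p * x $ q) = (\<Prod>r\<in>UNIV. ?f r (x $ r))" for x
    by (simp add: prod.distrib k_def power_add if_distrib[where f="\<lambda>n. _ ^ n"] cong: if_cong)
  have int: "integrable lborel (?f r)" for r
    by (rule integrable_std_normal_moment)
  have m: "(\<lambda>x. x $ p * x $ q) \<in> borel_measurable (lborel :: vec9 measure)"
    by measurable
  have "integrable lborel (\<lambda>x. ?d x * (x $ p * x $ q))"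
    unfolding * by (rule lborel_integral_prod_cart(1)[OF int])
  then show "integrable \<Omega> (\<lambda>\<omega>. g \<omega> $ p * g \<omega> $ q)"
    using distributed_integrable[OF D m] by (simp add: prod_nonneg)
  have "(\<integral>\<omega>. g \<omega> $ p * g \<omega> $ q \<partial>\<Omega>) = (\<integral>x. ?d x * (x $ p * x $ q) \<partial>lborel)"
    using distributed_integral[OF D m] by (simp add: prod_nonneg)
  also have "\<dots> = (\<Prod>r\<in>UNIV. integral\<^sup>L lborel (?f r))"
    unfolding * by (rule lborel_integral_prod_cart(2)[OF int])
  also have "\<dots> = (if p = q then 1 else 0)"
  proof (cases "p = q")
    case True
    have "integral\<^sup>L lborel (?f r) = 1" for r
      using integral_std_normal_moment_even[of 0] integral_std_normal_moment_even[of 1]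
      by (simp add: k_def True numeral_2_eq_2)
    then show ?thesis using True by simp
  next
    case False
    then have "integral\<^sup>L lborel (?f p) = 0"
      using integral_std_normal_moment_odd[of 0] by (simp add: k_def)
    then have "(\<Prod>r\<in>UNIV. integral\<^sup>L lborel (?f r)) = 0"
      by (intro prod_zero bexI[of _ p]) simp_all
    then show ?thesis using False by simp
  qed
  finally show "(\<integral>\<omega>. g \<omega> $ p * g \<omega> $ q \<partial>\<Omega>) = (if p = q then 1 else 0)" .
qed

lemma standard_gaussian_inner_square:
  assumes "standard_gaussian \<Omega> g"
  shows "integrable \<Omega> (\<lambda>\<omega>. (inner (g \<omega>) u)\<^sup>2)"
    and "(\<integral>\<omega>. (inner (g \<omega>) u)\<^sup>2 \<partial>\<Omega>) = inner u u"
proof -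
  note moment = standard_gaussian_coordinate_moment[OF assms]
  have *: "(inner (g \<omega>) u)\<^sup>2 = (\<Sum>p\<in>UNIV. \<Sum>q\<in>UNIV. u $ p * u $ q * (g \<omega> $ p * g \<omega> $ q))" for \<omega>
    by (simp add: inner_vec_def power2_eq_square sum_product mult_ac)
  show "integrable \<Omega> (\<lambda>\<omega>. (inner (g \<omega>) u)\<^sup>2)"
    unfolding * by (intro Bochner_Integration.integrable_sum integrable_mult_right moment)
  have "(\<integral>\<omega>. (inner (g \<omega>) u)\<^sup>2 \<partial>\<Omega>) = (\<Sum>p\<in>UNIV. \<Sum>q\<in>UNIV. u $ p * u $ q * (if p = q then 1 else 0))"
    unfolding * by (simp add: moment)
  also have "\<dots> = inner u u"
    by (simp add: inner_vec_def if_distrib[where f="\<lambda>x. _ * x"] cong: if_cong)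
  finally show "(\<integral>\<omega>. (inner (g \<omega>) u)\<^sup>2 \<partial>\<Omega>) = inner u u" .
qed

lemma norm_matrix_sq: "(norm A)\<^sup>2 = (\<Sum>i\<in>UNIV. \<Sum>j\<in>UNIV. (A $ i $ j)\<^sup>2)"
  for A :: "real^'n^'m"
  unfolding power2_norm_eq_inner inner_vec_def by (simp add: power2_eq_square)

lemma transpose_entry: "transpose A $ i $ j = A $ j $ i"
  by (simp add: transpose_def)

lemma inner_vectorize_right: "inner x (vectorize B) = inner (unvectorize x) B"
  by (metis inner_vectorize vectorize_unvectorize(1))

text \<open>The combination is the inner product of \<open>g\<close> with a vectorized image of two
  matrix units under an isometry, so its second moment is the squared norm of their combination. On
  the diagonal the two units coincide, whence \<open>(a + b)^2\<close>.\<close>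

lemma standard_gaussian_frame_square:
  assumes g: "standard_gaussian \<Omega> g" and U: "orthogonal_matrix U" and V: "orthogonal_matrix V"
  defines "X \<equiv> \<lambda>\<omega>. frame (transpose U) (transpose V) (unvectorize (g \<omega>))"
  shows "integrable \<Omega> (\<lambda>\<omega>. (a * X \<omega> $ i $ j + b * X \<omega> $ j $ i)\<^sup>2)"
    and "(\<integral>\<omega>. (a * X \<omega> $ i $ j + b * X \<omega> $ j $ i)\<^sup>2 \<partial>\<Omega>) = (if i = j then (a + b)\<^sup>2 else a\<^sup>2 + b\<^sup>2)"
proof -
  let ?E = "a *\<^sub>R axis i (axis j 1) + b *\<^sub>R axis j (axis i 1) :: mat3"
  let ?u = "vectorize (frame U V ?E)"
  have "inner (g \<omega>) ?u = inner (frame U V ?E) (unvectorize (g \<omega>))" for \<omega>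
    by (simp add: inner_vectorize_right inner_commute)
  then have *: "inner (g \<omega>) ?u = a * X \<omega> $ i $ j + b * X \<omega> $ j $ i" for \<omega>
    by (simp add: inner_frame_left X_def inner_add_left inner_axis')
  have "inner ?u ?u = (if i = j then (a + b)\<^sup>2 else a\<^sup>2 + b\<^sup>2)"
    using U V by (simp add: inner_add_left inner_add_right inner_axis_axis power2_eq_square algebra_simps)
  then show "integrable \<Omega> (\<lambda>\<omega>. (a * X \<omega> $ i $ j + b * X \<omega> $ j $ i)\<^sup>2)"
    "(\<integral>\<omega>. (a * X \<omega> $ i $ j + b * X \<omega> $ j $ i)\<^sup>2 \<partial>\<Omega>) = (if i = j then (a + b)\<^sup>2 else a\<^sup>2 + b\<^sup>2)"
    using standard_gaussian_inner_square[OF g, of ?u] by (simp_all add: *)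
qed

text \<open>A common form for the three maps whose energy is computed, each mixing only the
  positions \<open>(i, j)\<close> and \<open>(j, i)\<close>: the identity has coefficients 1 and 0,
  the derivative of the projection plus and minus \<open>1 / (s $ i + s $ j)\<close>, and the normal
  part 1/2 and 1/2.\<close>

lemma standard_gaussian_frame_norm:
  fixes a b :: "3 \<Rightarrow> 3 \<Rightarrow> real"
  assumes g: "standard_gaussian \<Omega> g" and U: "orthogonal_matrix U" and V: "orthogonal_matrix V"
    and f: "\<And>\<omega> i j. frame (transpose U) (transpose V) (f \<omega>) $ i $ j =
      a i j * frame (transpose U) (transpose V) (unvectorize (g \<omega>)) $ i $ j +
      b i j * frame (transpose U) (transpose V) (unvectorize (g \<omega>)) $ j $ i"
  shows "integrable \<Omega> (\<lambda>\<omega>. (norm (f \<omega>))\<^sup>2)"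
    and "(\<integral>\<omega>. (norm (f \<omega>))\<^sup>2 \<partial>\<Omega>) =
      (\<Sum>i\<in>UNIV. \<Sum>j\<in>UNIV. if i = j then (a i j + b i j)\<^sup>2 else (a i j)\<^sup>2 + (b i j)\<^sup>2)"
proof -
  note sq = standard_gaussian_frame_square[OF g U V]
  have "(norm (f \<omega>))\<^sup>2 = (norm (frame (transpose U) (transpose V) (f \<omega>)))\<^sup>2" for \<omega>
    using U V by simp
  then have *: "(norm (f \<omega>))\<^sup>2 = (\<Sum>i\<in>UNIV. \<Sum>j\<in>UNIV.
      (a i j * frame (transpose U) (transpose V) (unvectorize (g \<omega>)) $ i $ j +
       b i j * frame (transpose U) (transpose V) (unvectorize (g \<omega>)) $ j $ i)\<^sup>2)" for \<omega>
    by (simp only: norm_matrix_sq f)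
  show "integrable \<Omega> (\<lambda>\<omega>. (norm (f \<omega>))\<^sup>2)"
    unfolding * by (intro Bochner_Integration.integrable_sum sq(1))
  show "(\<integral>\<omega>. (norm (f \<omega>))\<^sup>2 \<partial>\<Omega>) =
      (\<Sum>i\<in>UNIV. \<Sum>j\<in>UNIV. if i = j then (a i j + b i j)\<^sup>2 else (a i j)\<^sup>2 + (b i j)\<^sup>2)"
    unfolding * by (simp add: Bochner_Integration.integral_sum Bochner_Integration.integrable_sum sq)
qed

lemma standard_gaussian_norm:
  assumes "standard_gaussian \<Omega> g"
  shows "integrable \<Omega> (\<lambda>\<omega>. (norm (g \<omega>))\<^sup>2)" "(\<integral>\<omega>. (norm (g \<omega>))\<^sup>2 \<partial>\<Omega>) = 9"
proof -
  note * = standard_gaussian_frame_norm[OF assms orthogonal_matrix_id orthogonal_matrix_id,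
    where f="\<lambda>\<omega>. unvectorize (g \<omega>)" and a="\<lambda>_ _. 1" and b="\<lambda>_ _. 0"]
  show "integrable \<Omega> (\<lambda>\<omega>. (norm (g \<omega>))\<^sup>2)" "(\<integral>\<omega>. (norm (g \<omega>))\<^sup>2 \<partial>\<Omega>) = 9"
    using * by (simp_all add: sum_3)
qed

section \<open>Retained and lost energy\<close>

definition retained_energy :: "real^3 \<Rightarrow> real" where
  "retained_energy s = (\<Sum>i\<in>UNIV. \<Sum>j\<in>UNIV. if i = j then 0 else 2 / (s $ i + s $ j)\<^sup>2)"

lemma frame_svd_rotation_deriv:
  assumes "orthogonal_matrix U" "orthogonal_matrix V"
  shows "frame (transpose U) (transpose V) (svd_rotation_deriv U s V A) $ i $ j =
    (frame (transpose U) (transpose V) A $ i $ j - frame (transpose U) (transpose V) A $ j $ i) / (s $ i + s $ j)"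
  using assms by (simp add: svd_rotation_deriv_def Let_def)

lemma J_SVD_energy:
  assumes g: "standard_gaussian \<Omega> g" and M: "is_svd M U s V" and det: "det M > 0"
  shows "integrable \<Omega> (\<lambda>\<omega>. (norm (transpose (J_SVD M) *v g \<omega>))\<^sup>2)"
    and "(\<integral>\<omega>. (norm (transpose (J_SVD M) *v g \<omega>))\<^sup>2 \<partial>\<Omega>) = retained_energy s"
proof -
  note O = is_svd_frame(1,2)[OF M]
  note * = standard_gaussian_frame_norm[OF g O,
    where f="\<lambda>\<omega>. svd_rotation_deriv U s V (unvectorize (g \<omega>))" and
      a="\<lambda>i j. 1 / (s $ i + s $ j)" and b="\<lambda>i j. - 1 / (s $ i + s $ j)"]
  have J: "norm (transpose (J_SVD M) *v g \<omega>) = norm (svd_rotation_deriv U s V (unvectorize (g \<omega>)))" for \<omega>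
    by (simp add: transpose_J_SVD[OF M det] J_SVD_mult[OF M det])
  show "integrable \<Omega> (\<lambda>\<omega>. (norm (transpose (J_SVD M) *v g \<omega>))\<^sup>2)"
    unfolding J by (rule *(1)) (simp add: frame_svd_rotation_deriv[OF O] diff_divide_distrib)
  have "(\<integral>\<omega>. (norm (transpose (J_SVD M) *v g \<omega>))\<^sup>2 \<partial>\<Omega>) =
    (\<Sum>i\<in>UNIV. \<Sum>j\<in>UNIV. if i = j then (1 / (s $ i + s $ j) + - 1 / (s $ i + s $ j))\<^sup>2
      else (1 / (s $ i + s $ j))\<^sup>2 + (- 1 / (s $ i + s $ j))\<^sup>2)"
    unfolding J by (rule *(2)) (simp add: frame_svd_rotation_deriv[OF O] diff_divide_distrib)
  then show "(\<integral>\<omega>. (norm (transpose (J_SVD M) *v g \<omega>))\<^sup>2 \<partial>\<Omega>) = retained_energy s"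
    by (simp add: retained_energy_def power_divide cong: if_cong)
qed

text \<open>Each of the six off-diagonal positions contributes 2/4.\<close>

lemma retained_energy_1: "(\<And>i. s $ i = 1) \<Longrightarrow> retained_energy s = 3"
  by (simp add: retained_energy_def sum_3)

text \<open>This is continuity at the vector of ones. Away from it the value does change: a common
  singular value \<open>t > 0\<close> gives \<open>3 / t^2\<close>, so nearness can only be
  expressed by a limit.\<close>

lemma retained_energy_near_1:
  assumes "\<epsilon> > 0"
  shows "\<exists>\<delta>>0. \<forall>s. (\<forall>i. \<bar>s $ i - 1\<bar> < \<delta>) \<longrightarrow> \<bar>retained_energy s - 3\<bar> < \<epsilon>"
proof -
  let ?e = "\<chi> i. 1 :: real^3"
  have "isCont (\<lambda>s :: real^3. if i = j then 0 else 2 / (s $ i + s $ j)\<^sup>2) ?e" for i j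
    by (cases "i = j") (auto intro!: continuous_intros)
  then have "isCont retained_energy ?e"
    unfolding retained_energy_def[abs_def] by (intro continuous_intros)
  then obtain d where d: "d > 0" "\<And>s. dist s ?e < d \<Longrightarrow> dist (retained_energy s) (retained_energy ?e) < \<epsilon>"
    using assms unfolding continuous_at_eps_delta by blast
  \<comment> \<open>Three coordinates, each off by less than \<open>d / 3\<close>, keep the l1
    distance below \<open>d\<close>.\<close>
  have "\<bar>retained_energy s - 3\<bar> < \<epsilon>" if "\<forall>i. \<bar>s $ i - 1\<bar> < d / 3" for s
  proof -
    have "dist s ?e \<le> (\<Sum>i\<in>UNIV. \<bar>(s - ?e) $ i\<bar>)"
      unfolding dist_norm by (rule norm_le_l1_cart)
    also have "\<dots> < d"
      using that[rule_format, of 1] that[rule_format, of 2] that[rule_format, of 3]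
      by (simp add: sum_3)
    finally show ?thesis
      using d(2)[of s] retained_energy_1[of ?e] by (simp add: dist_real_def)
  qed
  then show ?thesis using d(1) by (intro exI[of _ "d / 3"]) simp
qed

text \<open>Positive denominators cannot change where the skew part vanishes, so the kernel is the
  normal space for every \<open>M\<close> of positive determinant, however far from the
  rotations.\<close>

lemma kernel_J_SVD:
  assumes M: "is_svd M U s V" and det: "det M > 0"
  shows "{x. J_SVD M *v x = 0} = vectorize ` normal_SO3 (svd_rotation M)"
proof -
  note O = is_svd_frame(1,2)[OF M]
  let ?F = "frame (transpose U) (transpose V)"
  have s: "s $ i + s $ j \<noteq> 0" for i j
    using svd_det_pos(1)[OF M det, of i] svd_det_pos(1)[OF M det, of j] by linarith
  have R: "svd_rotation M = U ** transpose V"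
    using svd_rotation_eq[OF M svd_det_pos(1)[OF M det]] .
  have "J_SVD M *v x = 0 \<longleftrightarrow> unvectorize x \<in> normal_SO3 (svd_rotation M)" for x
  proof -
    have "J_SVD M *v x = 0 \<longleftrightarrow> svd_rotation_deriv U s V (unvectorize x) = 0"
      using norm_vectorize norm_eq_zero by (metis J_SVD_mult[OF M det])
    also have "\<dots> \<longleftrightarrow> ?F (svd_rotation_deriv U s V (unvectorize x)) = 0"
      using O by (simp add: frame_eq_0_iff)
    also have "\<dots> \<longleftrightarrow> (\<forall>i j. ?F (unvectorize x) $ i $ j = ?F (unvectorize x) $ j $ i)"
      using s by (simp add: vec_eq_iff frame_svd_rotation_deriv[OF O])
    also have "\<dots> \<longleftrightarrow> unvectorize x \<in> normal_SO3 (svd_rotation M)"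
      unfolding R normal_SO3_eq[OF O svd_det_pos(2)[OF M det]] mem_Collect_eq vec_eq_iff
        transpose_entry
      by blast
    finally show ?thesis .
  qed
  moreover have "{x. unvectorize x \<in> N} = vectorize ` N" for N
    using image_eqI[where f=vectorize and A=N] by fastforce
  ultimately show ?thesis by simp
qed

text \<open>Dividing by the symmetric \<open>s $ i + s $ j\<close> keeps the frame coordinates skew,
  so their symmetric part is 0.\<close>

lemma normal_part_svd_rotation_deriv:
  assumes U: "orthogonal_matrix U" and V: "orthogonal_matrix V"
    and rot: "rotation_matrix (U ** transpose V)"
  shows "normal_part (U ** transpose V) (svd_rotation_deriv U s V G) = 0"
proof -
  let ?B = "frame (transpose U) (transpose V) (svd_rotation_deriv U s V G)"
  have "?B $ i $ j + ?B $ j $ i = 0" for i j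
    unfolding frame_svd_rotation_deriv[OF U V] add.commute[of "s $ j"] add_divide_distrib[symmetric]
    by simp
  then have "?B + transpose ?B = 0"
    by (simp add: vec_eq_iff transpose_entry)
  then show ?thesis
    using U V by (simp add: normal_part_eq[OF assms] frame_eq_0_iff)
qed

text \<open>Three diagonal positions contribute 1 each and six off-diagonal ones 1/2 each, matching
  the two three-dimensional summands.\<close>

lemma normal_part_energy:
  assumes g: "standard_gaussian \<Omega> g" and U: "orthogonal_matrix U" and V: "orthogonal_matrix V"
    and rot: "rotation_matrix (U ** transpose V)"
  shows "(\<integral>\<omega>. (norm (normal_part (U ** transpose V) (unvectorize (g \<omega>))))\<^sup>2 \<partial>\<Omega>) = 6"
proof -
  have "(\<integral>\<omega>. (norm (normal_part (U ** transpose V) (unvectorize (g \<omega>))))\<^sup>2 \<partial>\<Omega>) =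
    (\<Sum>i\<in>(UNIV :: 3 set). \<Sum>j\<in>UNIV. if i = j then (1/2 + 1/2)\<^sup>2 else (1/2)\<^sup>2 + (1/2)\<^sup>2)"
    by (rule standard_gaussian_frame_norm(2)[OF g U V])
       (use U V in \<open>simp add: normal_part_eq[OF U V rot] transpose_entry algebra_simps\<close>)
  also have "\<dots> = 6" by (simp add: sum_3 power2_eq_square)
  finally show ?thesis .
qed

section \<open>Gradients of the two training losses\<close>

lemma GDERIV_svd_train_loss:
  assumes M: "is_svd M U s V" and det: "det M > 0" and L: "GDERIV L (svd_rotation M) :> G"
  shows "GDERIV (svd_train_loss L) M :> svd_rotation_deriv U s V G"
proof -
  have "((L \<circ> svd_rotation) has_derivative ((\<lambda>h. inner h G) \<circ> svd_rotation_deriv U s V)) (at M)"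
    using svd_rotation_has_derivative[OF M det] L unfolding gderiv_def by (rule diff_chain_at)
  then show ?thesis
    by (simp add: gderiv_def o_def svd_train_loss_def[abs_def] svd_rotation_deriv_self_adjoint)
qed

lemma GDERIV_direct_loss: "GDERIV (direct_loss T) M :> 2 *\<^sub>R (M - T)"
  unfolding gderiv_def direct_loss_def[abs_def] power2_norm_eq_inner
  by (auto intro!: derivative_eq_intros simp: inner_commute)

theorem proposition1:
  fixes \<Omega> :: "'w measure" and g :: "'w \<Rightarrow> vec9"
  assumes "prob_space \<Omega>" and "standard_gaussian \<Omega> g"
  shows
    \<comment> \<open>the projection to a rotation and its Jacobian are well defined\<close>
    "(\<forall>M U s V. is_svd M U s V \<and> det M > 0 \<longrightarrow>
        svd_rotation M = U ** transpose V \<and> svd_rotation M \<in> SO3 \<and>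
        infdist M SO3 = norm (M - svd_rotation M) \<and>
        (\<lambda>x. vectorize (svd_rotation (unvectorize x))) differentiable (at (vectorize M)))
     \<and>
     \<comment> \<open>(1), on the rotation group and near it\<close>
     (\<forall>M U s V. is_svd M U s V \<and> det M > 0 \<and> (\<forall>i. s $ i = 1) \<longrightarrow>
        GIR \<Omega> g (J_SVD M) = 1/3 \<and>
        prob_space.expectation \<Omega>
            (\<lambda>\<omega>. (norm (g \<omega>))\<^sup>2 - (norm (transpose (J_SVD M) *v g \<omega>))\<^sup>2)
          = 2/3 * prob_space.expectation \<Omega> (\<lambda>\<omega>. (norm (g \<omega>))\<^sup>2))
     \<and>
     (\<forall>\<epsilon>>0. \<exists>\<delta>>0. \<forall>M U s V. is_svd M U s V \<and> det M > 0 \<and> (\<forall>i. \<bar>s $ i - 1\<bar> < \<delta>) \<longrightarrow>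
        \<bar>GIR \<Omega> g (J_SVD M) - 1/3\<bar> < \<epsilon>)
     \<and>
     \<comment> \<open>(2)\<close>
     (\<forall>M. J_id M = mat 1 \<and> GIR \<Omega> g (J_id M) = 1 \<and>
        prob_space.expectation \<Omega> (\<lambda>\<omega>. (norm (transpose (J_id M) *v g \<omega>))\<^sup>2)
          = prob_space.expectation \<Omega> (\<lambda>\<omega>. (norm (g \<omega>))\<^sup>2))
     \<and>
     \<comment> \<open>the lost component is the normal space, of dimension 6 = 3 + 3\<close>
     (\<forall>M U s V. is_svd M U s V \<and> det M > 0 \<longrightarrow>
        subspace (normal_SO3 (svd_rotation M)) \<and>
        {x. transpose (J_SVD M) *v x = 0} = vectorize ` normal_SO3 (svd_rotation M) \<and>
        {x. J_SVD M *v x = 0} = vectorize ` normal_SO3 (svd_rotation M) \<and>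
        dim (normal_SO3 (svd_rotation M)) = 6 \<and>
        prob_space.expectation \<Omega>
            (\<lambda>\<omega>. (norm (normal_part (svd_rotation M) (unvectorize (g \<omega>))))\<^sup>2)
          = 2/3 * prob_space.expectation \<Omega> (\<lambda>\<omega>. (norm (g \<omega>))\<^sup>2) \<and>
        normal_SO3 (svd_rotation M) =
          {A + B | A B. A \<in> singular_value_directions U V \<and>
                        B \<in> symmetric_offdiagonal_directions U V} \<and>
        (\<forall>A \<in> singular_value_directions U V.
           \<forall>B \<in> symmetric_offdiagonal_directions U V. orthogonal A B) \<and>
        dim (singular_value_directions U V) = 3 \<and>
        dim (symmetric_offdiagonal_directions U V) = 3 \<and>
        (\<forall>d. (s + d) $ 1 \<ge> (s + d) $ 2 \<and> (s + d) $ 2 \<ge> (s + d) $ 3 \<and> (s + d) $ 3 \<ge> 0 \<longrightarrow>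
           is_svd (M + U ** diag_matrix d ** transpose V) U (s + d) V))
     \<and>
     \<comment> \<open>the normal component carries the distance to the rotation group;
         SVD-Train discards it, direct regression retains it\<close>
     (\<forall>M U s V. is_svd M U s V \<and> det M > 0 \<longrightarrow>
        M - svd_rotation M \<in> normal_SO3 (svd_rotation M) \<and>
        (\<forall>L G. GDERIV L (svd_rotation M) :> G \<longrightarrow>
           (GDERIV (svd_train_loss L) M :> unvectorize (transpose (J_SVD M) *v vectorize G)) \<and>
           normal_part (svd_rotation M) (unvectorize (transpose (J_SVD M) *v vectorize G)) = 0) \<and>
        (\<forall>T \<in> SO3.
           GDERIV (direct_loss T) M :>
             unvectorize (transpose (J_id M) *v vectorize (2 *\<^sub>R (M - T)))) \<and>
        (\<forall>G. normal_part (svd_rotation M) (unvectorize (transpose (J_id M) *v vectorize G))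
             = normal_part (svd_rotation M) G))"
proof -
  note g = assms(2)
  have R: "svd_rotation M = U ** transpose V" if "is_svd M U s V" "det M > 0" for M U s V
    using svd_rotation_eq[OF that(1) svd_det_pos(1)[OF that]] .
  note N = standard_gaussian_norm[OF g]
  have GIR: "GIR \<Omega> g (J_SVD M) = retained_energy s / 9" if "is_svd M U s V" "det M > 0" for M U s V
    by (simp only: GIR_def J_SVD_energy(2)[OF g that] N)
  show ?thesis
  proof (intro conjI)
    show "\<forall>M U s V. is_svd M U s V \<and> det M > 0 \<longrightarrow>
        svd_rotation M = U ** transpose V \<and> svd_rotation M \<in> SO3 \<and>
        infdist M SO3 = norm (M - svd_rotation M) \<and>
        (\<lambda>x. vectorize (svd_rotation (unvectorize x))) differentiable (at (vectorize M))"
      using R svd_rotation_SO3 infdist_SO3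
        vec_jacobian_has_derivative[OF svd_rotation_has_derivative, THEN differentiableI]
      by blast
    show "\<forall>M U s V. is_svd M U s V \<and> det M > 0 \<and> (\<forall>i. s $ i = 1) \<longrightarrow>
        GIR \<Omega> g (J_SVD M) = 1/3 \<and>
        prob_space.expectation \<Omega>
            (\<lambda>\<omega>. (norm (g \<omega>))\<^sup>2 - (norm (transpose (J_SVD M) *v g \<omega>))\<^sup>2)
          = 2/3 * prob_space.expectation \<Omega> (\<lambda>\<omega>. (norm (g \<omega>))\<^sup>2)"
    proof (intro allI impI, elim conjE, intro conjI)
      fix M U s V assume M: "is_svd M U s V" "det M > 0" and 1: "\<forall>i. s $ i = 1"
      note E = J_SVD_energy[OF g M, unfolded retained_energy_1[OF 1[rule_format]]]
      show "GIR \<Omega> g (J_SVD M) = 1/3"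
        using retained_energy_1[of s] 1 by (simp add: GIR[OF M])
      show "prob_space.expectation \<Omega>
            (\<lambda>\<omega>. (norm (g \<omega>))\<^sup>2 - (norm (transpose (J_SVD M) *v g \<omega>))\<^sup>2)
          = 2/3 * prob_space.expectation \<Omega> (\<lambda>\<omega>. (norm (g \<omega>))\<^sup>2)"
        by (simp only: Bochner_Integration.integral_diff[OF N(1) E(1)] N(2) E(2))
    qed
    show "\<forall>\<epsilon>>0. \<exists>\<delta>>0. \<forall>M U s V. is_svd M U s V \<and> det M > 0 \<and> (\<forall>i. \<bar>s $ i - 1\<bar> < \<delta>) \<longrightarrow>
        \<bar>GIR \<Omega> g (J_SVD M) - 1/3\<bar> < \<epsilon>"
    proof (intro allI impI)
      fix \<epsilon> :: real assume "\<epsilon> > 0"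
      then obtain \<delta> where "\<delta> > 0"
        and \<delta>: "\<And>s. \<forall>i. \<bar>s $ i - 1\<bar> < \<delta> \<Longrightarrow> \<bar>retained_energy s - 3\<bar> < 9 * \<epsilon>"
        \<comment> \<open>The factor 9 is the total energy, by which the retained energy is
          divided.\<close>
        using retained_energy_near_1[of "9 * \<epsilon>"] by auto
      have "\<bar>GIR \<Omega> g (J_SVD M) - 1/3\<bar> < \<epsilon>"
        if M: "is_svd M U s V" "det M > 0" and "\<forall>i. \<bar>s $ i - 1\<bar> < \<delta>" for M U s V
        using \<delta>[OF that(3)] unfolding GIR[OF M] by (simp add: abs_less_iff field_simps)
      with \<open>\<delta> > 0\<close> show "\<exists>\<delta>>0. \<forall>M U s V. is_svd M U s V \<and> det M > 0 \<and>
          (\<forall>i. \<bar>s $ i - 1\<bar> < \<delta>) \<longrightarrow> \<bar>GIR \<Omega> g (J_SVD M) - 1/3\<bar> < \<epsilon>"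
        by blast
    qed
    show "\<forall>M. J_id M = mat 1 \<and> GIR \<Omega> g (J_id M) = 1 \<and>
        prob_space.expectation \<Omega> (\<lambda>\<omega>. (norm (transpose (J_id M) *v g \<omega>))\<^sup>2)
          = prob_space.expectation \<Omega> (\<lambda>\<omega>. (norm (g \<omega>))\<^sup>2)"
      by (simp add: J_id_eq GIR_def N(2))
    show "\<forall>M U s V. is_svd M U s V \<and> det M > 0 \<longrightarrow>
        subspace (normal_SO3 (svd_rotation M)) \<and>
        {x. transpose (J_SVD M) *v x = 0} = vectorize ` normal_SO3 (svd_rotation M) \<and>
        {x. J_SVD M *v x = 0} = vectorize ` normal_SO3 (svd_rotation M) \<and>
        dim (normal_SO3 (svd_rotation M)) = 6 \<and>
        prob_space.expectation \<Omega>
            (\<lambda>\<omega>. (norm (normal_part (svd_rotation M) (unvectorize (g \<omega>))))\<^sup>2)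
          = 2/3 * prob_space.expectation \<Omega> (\<lambda>\<omega>. (norm (g \<omega>))\<^sup>2) \<and>
        normal_SO3 (svd_rotation M) =
          {A + B | A B. A \<in> singular_value_directions U V \<and>
                        B \<in> symmetric_offdiagonal_directions U V} \<and>
        (\<forall>A \<in> singular_value_directions U V.
           \<forall>B \<in> symmetric_offdiagonal_directions U V. orthogonal A B) \<and>
        dim (singular_value_directions U V) = 3 \<and>
        dim (symmetric_offdiagonal_directions U V) = 3 \<and>
        (\<forall>d. (s + d) $ 1 \<ge> (s + d) $ 2 \<and> (s + d) $ 2 \<ge> (s + d) $ 3 \<and> (s + d) $ 3 \<ge> 0 \<longrightarrow>
           is_svd (M + U ** diag_matrix d ** transpose V) U (s + d) V)"
      (is "\<forall>M U s V. _ \<longrightarrow> ?normal M U s V")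
    proof (intro allI impI, elim conjE)
      fix M U s V assume M: "is_svd M U s V" "det M > 0"
      note O = is_svd_frame(1,2)[OF M(1)] and rot = svd_det_pos(2)[OF M]
      have "subspace (normal_SO3 (svd_rotation M))"
        unfolding normal_SO3_def by (rule subspace_orthogonal_comp)
      moreover have "prob_space.expectation \<Omega>
            (\<lambda>\<omega>. (norm (normal_part (svd_rotation M) (unvectorize (g \<omega>))))\<^sup>2)
          = 2/3 * prob_space.expectation \<Omega> (\<lambda>\<omega>. (norm (g \<omega>))\<^sup>2)"
        unfolding R[OF M] normal_part_energy[OF g O rot] N(2) by simp
      moreover have "normal_SO3 (svd_rotation M) =
          {A + B | A B. A \<in> singular_value_directions U V \<and> B \<in> symmetric_offdiagonal_directions U V}"
        unfolding R[OF M] normal_SO3_decomposition[OF O rot]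
          singular_value_directions_eq symmetric_offdiagonal_directions_eq by auto
      moreover have "\<forall>A \<in> singular_value_directions U V.
           \<forall>B \<in> symmetric_offdiagonal_directions U V. orthogonal A B"
        using O by (auto simp: singular_value_directions_eq symmetric_offdiagonal_directions_eq
          orthogonal_def inner_diag_offdiag)
      moreover have "is_svd (M + U ** diag_matrix d ** transpose V) U (s + d) V"
        if "(s + d) $ 1 \<ge> (s + d) $ 2 \<and> (s + d) $ 2 \<ge> (s + d) $ 3 \<and> (s + d) $ 3 \<ge> 0" for d
      proof -
        have "M + frame U V (diag_matrix d) = frame U V (diag_matrix (s + d))"
          by (subst is_svd_frame(3)[OF M(1)])
             (simp add: linear_add[OF linear_frame] linear_add[OF linear_diag_matrix])
        then show ?thesis
          using O that by (simp add: is_svd_def frame_def)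
      qed
      ultimately show "?normal M U s V"
        using kernel_J_SVD[OF M] transpose_J_SVD[OF M] dim_normal_SO3[OF O rot, folded R[OF M]]
          dim_singular_value_directions[OF O] dim_symmetric_offdiagonal_directions[OF O]
        by (intro conjI allI impI) (simp_all only:)
    qed
    show "\<forall>M U s V. is_svd M U s V \<and> det M > 0 \<longrightarrow>
        M - svd_rotation M \<in> normal_SO3 (svd_rotation M) \<and>
        (\<forall>L G. GDERIV L (svd_rotation M) :> G \<longrightarrow>
           (GDERIV (svd_train_loss L) M :> unvectorize (transpose (J_SVD M) *v vectorize G)) \<and>
           normal_part (svd_rotation M) (unvectorize (transpose (J_SVD M) *v vectorize G)) = 0) \<and>
        (\<forall>T \<in> SO3.
           GDERIV (direct_loss T) M :>
             unvectorize (transpose (J_id M) *v vectorize (2 *\<^sub>R (M - T)))) \<and>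
        (\<forall>G. normal_part (svd_rotation M) (unvectorize (transpose (J_id M) *v vectorize G))
             = normal_part (svd_rotation M) G)"
    proof (intro allI impI, elim conjE, intro conjI allI impI ballI)
      fix M U s V assume M: "is_svd M U s V" "det M > 0"
      note O = is_svd_frame(1,2)[OF M(1)] and rot = svd_det_pos(2)[OF M]
      \<comment> \<open>In the frame the residual is diagonal with entries \<open>s $ i - 1\<close>;
        it is symmetric, hence normal, and records the deviation of each singular value from
        1.\<close>
      have "frame (transpose U) (transpose V) (M - U ** transpose V) = diag_matrix s - mat 1"
      proof -
        have "U ** transpose V = frame U V (mat 1)" by (simp add: frame_def)
        then show ?thesis
          using O is_svd_frame(3)[OF M(1)] by (simp add: linear_diff[OF linear_frame])
      qed
      then show "M - svd_rotation M \<in> normal_SO3 (svd_rotation M)"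
        by (simp add: R[OF M] normal_SO3_eq[OF O rot] transpose_diff)
      have J: "unvectorize (transpose (J_SVD M) *v vectorize G) = svd_rotation_deriv U s V G" for G
        by (simp only: transpose_J_SVD[OF M] J_SVD_mult[OF M] vectorize_unvectorize)
      show "GDERIV (svd_train_loss L) M :> unvectorize (transpose (J_SVD M) *v vectorize G)"
        if "GDERIV L (svd_rotation M) :> G" for L G
        unfolding J by (rule GDERIV_svd_train_loss[OF M that])
      show "normal_part (svd_rotation M) (unvectorize (transpose (J_SVD M) *v vectorize G)) = 0" for G
        unfolding J R[OF M] by (rule normal_part_svd_rotation_deriv[OF O rot])
    next
      fix M T
      show "GDERIV (direct_loss T) M :> unvectorize (transpose (J_id M) *v vectorize (2 *\<^sub>R (M - T)))"
        using GDERIV_direct_loss by (simp add: J_id_eq)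
    qed (simp add: J_id_eq)
  qed
qed

end
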